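(* Fix $\rho\in\mathcal P^\infty_+(M)$ and let $E\subset H^W_\rho\cap C^\infty(M;TM)$ be finite dimensional. Let $R:E\to E$ be positive definite and self-adjoint in $L^2(\rho;TM)$. There exists a smooth finite rank vector-valued kernel whose reproducing kernel Hilbert space is $E$ (as a vector space) and for which $$S_\rho u=Ru\quad\text{for every }u\in E .$$ Consequently, the Stein law tangent generated by a force $u=\operatorname{grad}f\in E$ is $A_\rho Ru$. The choices $R=\mathrm{id}$ and $R=a\,\mathrm{id}$ ($a>0$) produce respectively exact particle agreement, $S_\rho u=u$ for $u\in E$, and a prescribed time change, $S_\rho u=au$ for $u\in E$.
   Context: $M$ is a connected, closed, oriented Riemannian manifold with metric $g$ and volume $\mathrm{vol}$; $\mathcal P^\infty_+(M)$ is the set of smooth strictly positive $\rho$ with $\int_M\rho\,d\mathrm{vol}=1$. $L^2(\rho;TM)$ has inner product $\int_M\langle u,v\rangle_g\rho\,d\mathrm{vol}$, and $H^W_\rho$ is the closure in it of $\{\operatorname{grad}f:f\in C^\infty(M)\}$. A vector-valued kernel is a positive definite $k(x,y):T_xM\to T_yM$ with $k(y,x)=k(x,y)^*$, and its reproducing kernel Hilbert space $\mathcal H_k$ of vector fields satisfies $\langle v,k(x,\cdot)\xi\rangle_{\mathcal H_k}=\langle v(x),\xi\rangle_g$; it has finite rank if $\mathcal H_k$ is finite dimensional. $I_\rho:\mathcal H_k\to L^2(\rho;TM)$ is the inclusion, $I_\rho^*$ its adjoint, $S_\rho=I_\rho I_\rho^*$, $A_\rho v=-\operatorname{div}(\rho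 v)$. The Stein law tangent generated by $f$ is $K^S_\rho f=A_\rho S_\rho\operatorname{grad}f$; the Otto particle response to $u=\operatorname{grad}f$ is $u$ itself and the Stein one is $S_\rho u$. *)

theory Defs
  imports "HOL-Analysis.Analysis" "HOL-Library.Function_Algebras"
begin

section \<open>Functions as a real vector space\<close>

text \<open>Tangent vectors and vector fields below are functions; this instance gives them
  pointwise linear structure, and with it \<^const>\<open>subspace\<close> and \<^const>\<open>span\<close>.\<close>

instantiation "fun" :: (type, real_vector) real_vector
begin

definition scaleR_fun :: "real \<Rightarrow> ('a \<Rightarrow> 'b) \<Rightarrow> 'a \<Rightarrow> 'b"
  where "scaleR_fun c f = (\<lambda>x. c *\<^sub>R f x)"

instance
  by standard (simp_all add: scaleR_fun_def fun_eq_iff algebra_simps)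

end

text \<open>The Hilbert space notions take the carrier \<open>V\<close> and the inner product \<open>ip\<close> as arguments,
  since several different inner products live on the same type.\<close>

definition inner_product_on :: "'v::real_vector set \<Rightarrow> ('v \<Rightarrow> 'v \<Rightarrow> real) \<Rightarrow> bool"
  where "inner_product_on V ip \<longleftrightarrow>
    (\<forall>u\<in>V. \<forall>v\<in>V. ip u v = ip v u) \<and>
    (\<forall>u\<in>V. \<forall>v\<in>V. \<forall>w\<in>V. ip (u + v) w = ip u w + ip v w) \<and>
    (\<forall>c. \<forall>u\<in>V. \<forall>v\<in>V. ip (c *\<^sub>R u) v = c * ip u v) \<and>
    (\<forall>u\<in>V. u \<noteq> 0 \<longrightarrow> ip u u > 0)"

definition hilbert_space_on :: "'v::real_vector set \<Rightarrow> ('v \<Rightarrow> 'v \<Rightarrow> real) \<Rightarrow> bool"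
  where "hilbert_space_on V ip \<longleftrightarrow>
    subspace V \<and> inner_product_on V ip \<and>
    (\<forall>X::nat \<Rightarrow> 'v. (\<forall>n. X n \<in> V) \<and>
        (\<forall>e>0. \<exists>N. \<forall>m\<ge>N. \<forall>n\<ge>N. ip (X m - X n) (X m - X n) < e)
      \<longrightarrow> (\<exists>v\<in>V. (\<lambda>n. ip (X n - v) (X n - v)) \<longlonglongrightarrow> 0))"

definition finite_dimensional :: "'v::real_vector set \<Rightarrow> bool"
  where "finite_dimensional V \<longleftrightarrow> subspace V \<and> (\<exists>B. finite B \<and> V = span B)"


section \<open>Smoothness in Euclidean space\<close>

text \<open>Both notions are meant for open \<open>S\<close>.\<close>

primrec Ck_on :: "nat \<Rightarrow> ('a::euclidean_space \<Rightarrow> 'b::real_normed_vector) \<Rightarrow> 'a set \<Rightarrow> bool"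
  where
    "Ck_on 0 f S \<longleftrightarrow> continuous_on S f"
  | "Ck_on (Suc k) f S \<longleftrightarrow> (\<forall>x\<in>S. f differentiable (at x)) \<and>
       (\<forall>v. Ck_on k (\<lambda>x. frechet_derivative f (at x) v) S)"

definition smooth_on :: "('a::euclidean_space \<Rightarrow> 'b::real_normed_vector) \<Rightarrow> 'a set \<Rightarrow> bool"
  where "smooth_on f S \<longleftrightarrow> (\<forall>k. Ck_on k f S)"


section \<open>Closed oriented Riemannian manifolds\<close>

text \<open>The manifold is the topological space \<open>'m\<close>, of dimension \<open>CARD('n)\<close>, with an atlas indexed
  by the type \<open>'i\<close>.  A tangent vector at \<open>p\<close> is a family \<open>\<xi> :: 'i \<Rightarrow> real^'n\<close> of coordinate vectors,
  one for each chart around \<open>p\<close>, related by the Jacobians of the transition maps; the entries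
  at charts that do not contain \<open>p\<close> are set to 0, so that \<open>\<xi>\<close> is unique.\<close>

type_synonym ('i, 'n) tvec = "'i \<Rightarrow> real ^ 'n"
type_synonym ('i, 'm, 'n) vfield = "'m \<Rightarrow> ('i, 'n) tvec"
type_synonym ('i, 'm, 'n) vkernel = "'m \<Rightarrow> 'm \<Rightarrow> ('i, 'n) tvec \<Rightarrow> ('i, 'n) tvec"

record ('i, 'm, 'n) riemannian =
  chart_dom :: "'i \<Rightarrow> 'm set"
  chart_map :: "'i \<Rightarrow> 'm \<Rightarrow> real ^ 'n"
  metric :: "'m \<Rightarrow> ('i, 'n) tvec \<Rightarrow> ('i, 'n) tvec \<Rightarrow> real"
  vol :: "'m measure"

definition chart_img :: "('i, 'm, 'n::finite) riemannian \<Rightarrow> 'i \<Rightarrow> (real ^ 'n) set"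
  where "chart_img M i = chart_map M i ` chart_dom M i"

definition chart_inv :: "('i, 'm, 'n::finite) riemannian \<Rightarrow> 'i \<Rightarrow> real ^ 'n \<Rightarrow> 'm"
  where "chart_inv M i = inv_into (chart_dom M i) (chart_map M i)"

definition transition :: "('i, 'm, 'n::finite) riemannian \<Rightarrow> 'i \<Rightarrow> 'i \<Rightarrow> real ^ 'n \<Rightarrow> real ^ 'n"
  where "transition M i j = chart_map M j \<circ> chart_inv M i"

definition jacobian ::
    "('i, 'm, 'n::finite) riemannian \<Rightarrow> 'i \<Rightarrow> 'i \<Rightarrow> 'm \<Rightarrow> real ^ 'n \<Rightarrow> real ^ 'n"
  where "jacobian M i j p = frechet_derivative (transition M i j) (at (chart_map M i p))"

text \<open>The orientation is carried by the atlas: all transition maps have positive Jacobian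
  determinant.\<close>

definition oriented_smooth_atlas ::
    "('i, 'm::{t2_space, second_countable_topology}, 'n::finite) riemannian \<Rightarrow> bool"
  where "oriented_smooth_atlas M \<longleftrightarrow>
    (\<Union>i. chart_dom M i) = UNIV \<and>
    (\<forall>i. open (chart_dom M i) \<and> open (chart_img M i) \<and>
         homeomorphism (chart_dom M i) (chart_img M i) (chart_map M i) (chart_inv M i)) \<and>
    (\<forall>i j. smooth_on (transition M i j) (chart_map M i ` (chart_dom M i \<inter> chart_dom M j))) \<and>
    (\<forall>i j. \<forall>p \<in> chart_dom M i \<inter> chart_dom M j. det (matrix (jacobian M i j p)) > 0)"

definition tangent_space :: "('i, 'm, 'n::finite) riemannian \<Rightarrow> 'm \<Rightarrow> ('i, 'n) tvec set"
  where "tangent_space M p = {\<xi>.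
    (\<forall>i j. p \<in> chart_dom M i \<inter> chart_dom M j \<longrightarrow> \<xi> j = jacobian M i j p (\<xi> i)) \<and>
    (\<forall>i. p \<notin> chart_dom M i \<longrightarrow> \<xi> i = 0)}"

text \<open>The tangent vector at \<open>p\<close> whose coordinate vector in the chart \<open>i\<close> is \<open>b\<close>.\<close>

definition tvec_of_coords ::
    "('i, 'm, 'n::finite) riemannian \<Rightarrow> 'i \<Rightarrow> 'm \<Rightarrow> real ^ 'n \<Rightarrow> ('i, 'n) tvec"
  where "tvec_of_coords M i p b =
    (\<lambda>j. if p \<in> chart_dom M j then jacobian M i j p b else 0)"

definition gram_matrix ::
    "('i, 'm, 'n::finite) riemannian \<Rightarrow> 'i \<Rightarrow> 'm \<Rightarrow> real ^ 'n ^ 'n"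
  where "gram_matrix M i p = (\<chi> a b.
    metric M p (tvec_of_coords M i p (axis a 1)) (tvec_of_coords M i p (axis b 1)))"

definition riemannian_metric :: "('i, 'm, 'n::finite) riemannian \<Rightarrow> bool"
  where "riemannian_metric M \<longleftrightarrow>
    (\<forall>p. inner_product_on (tangent_space M p) (metric M p)) \<and>
    (\<forall>i a b. smooth_on (\<lambda>y. gram_matrix M i (chart_inv M i y) $ a $ b) (chart_img M i))"

definition vol_density :: "('i, 'm, 'n::finite) riemannian \<Rightarrow> 'i \<Rightarrow> real ^ 'n \<Rightarrow> real"
  where "vol_density M i y = sqrt (det (gram_matrix M i (chart_inv M i y)))"

text \<open>The Riemannian volume is the unique Borel measure that has density \<open>sqrt (det g)\<close> in every
  chart.\<close>

definition riemannian_volume ::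
    "('i, 'm::{t2_space, second_countable_topology}, 'n::finite) riemannian \<Rightarrow> bool"
  where "riemannian_volume M \<longleftrightarrow>
    sets (vol M) = sets borel \<and>
    (\<forall>i. \<forall>A\<in>sets borel. A \<subseteq> chart_dom M i \<longrightarrow>
      emeasure (vol M) A = (\<integral>\<^sup>+y\<in>chart_map M i ` A. ennreal (vol_density M i y) \<partial>lborel))"

definition closed_oriented_riemannian_manifold ::
    "('i, 'm::{t2_space, second_countable_topology}, 'n::finite) riemannian \<Rightarrow> bool"
  where "closed_oriented_riemannian_manifold M \<longleftrightarrow>
    connected (UNIV :: 'm set) \<and> compact (UNIV :: 'm set) \<and>
    oriented_smooth_atlas M \<and> riemannian_metric M \<and> riemannian_volume M"


section \<open>Smooth functions, vector fields, gradient and divergence\<close>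

definition smooth_function :: "('i, 'm, 'n::finite) riemannian \<Rightarrow> ('m \<Rightarrow> real) \<Rightarrow> bool"
  where "smooth_function M f \<longleftrightarrow> (\<forall>i. smooth_on (f \<circ> chart_inv M i) (chart_img M i))"

definition vector_field :: "('i, 'm, 'n::finite) riemannian \<Rightarrow> ('i, 'm, 'n) vfield \<Rightarrow> bool"
  where "vector_field M v \<longleftrightarrow> (\<forall>p. v p \<in> tangent_space M p)"

definition smooth_vector_field :: "('i, 'm, 'n::finite) riemannian \<Rightarrow> ('i, 'm, 'n) vfield \<Rightarrow> bool"
  where "smooth_vector_field M v \<longleftrightarrow> vector_field M v \<and>
    (\<forall>i. smooth_on (\<lambda>y. v (chart_inv M i y) i) (chart_img M i))"

definition some_chart :: "('i, 'm, 'n::finite) riemannian \<Rightarrow> 'm \<Rightarrow> 'i"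
  where "some_chart M p = (SOME i. p \<in> chart_dom M i)"

text \<open>The next two local expressions do not depend on the chart.\<close>

definition differential ::
    "('i, 'm, 'n::finite) riemannian \<Rightarrow> ('m \<Rightarrow> real) \<Rightarrow> 'm \<Rightarrow> ('i, 'n) tvec \<Rightarrow> real"
  where "differential M f p \<xi> = (let i = some_chart M p in
    frechet_derivative (f \<circ> chart_inv M i) (at (chart_map M i p)) (\<xi> i))"

definition divergence ::
    "('i, 'm, 'n::finite) riemannian \<Rightarrow> ('i, 'm, 'n) vfield \<Rightarrow> 'm \<Rightarrow> real"
  where "divergence M v p = (let i = some_chart M p; y = chart_map M i p in
    (\<Sum>a\<in>UNIV. frechet_derivative (\<lambda>z. vol_density M i z * v (chart_inv M i z) i $ a) (at y)
       (axis a 1)) / vol_density M i y)"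

definition gradient :: "('i, 'm, 'n::finite) riemannian \<Rightarrow> ('m \<Rightarrow> real) \<Rightarrow> ('i, 'm, 'n) vfield"
  where "gradient M f p = (THE \<xi>. \<xi> \<in> tangent_space M p \<and>
    (\<forall>\<eta>\<in>tangent_space M p. metric M p \<xi> \<eta> = differential M f p \<eta>))"


section \<open>Densities and the weighted \<open>L\<^sup>2\<close> space\<close>

definition smooth_positive_density :: "('i, 'm, 'n::finite) riemannian \<Rightarrow> ('m \<Rightarrow> real) \<Rightarrow> bool"
  where "smooth_positive_density M \<rho> \<longleftrightarrow>
    smooth_function M \<rho> \<and> (\<forall>p. \<rho> p > 0) \<and> (\<integral>p. \<rho> p \<partial>vol M) = 1"

text \<open>Elements of \<open>L\<^sup>2(\<rho>;TM)\<close> are handled through representatives: no quotient by almost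
  everywhere equality is taken.\<close>

definition L2_fields ::
    "('i, 'm, 'n::finite) riemannian \<Rightarrow> ('m \<Rightarrow> real) \<Rightarrow> ('i, 'm, 'n) vfield set"
  where "L2_fields M \<rho> = {v. vector_field M v \<and>
    (\<forall>i. (\<lambda>p. v p i) \<in> borel_measurable (vol M)) \<and>
    integrable (vol M) (\<lambda>p. metric M p (v p) (v p) * \<rho> p)}"

definition L2_inner ::
    "('i, 'm, 'n::finite) riemannian \<Rightarrow> ('m \<Rightarrow> real) \<Rightarrow> ('i, 'm, 'n) vfield \<Rightarrow>
      ('i, 'm, 'n) vfield \<Rightarrow> real"
  where "L2_inner M \<rho> u v = (\<integral>p. metric M p (u p) (v p) * \<rho> p \<partial>vol M)"

text \<open>\<open>H\<^sup>W\<^sub>\<rho>\<close>, the \<open>L\<^sup>2(\<rho>)\<close> closure of the smooth gradients.\<close>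

definition wasserstein_tangent_space ::
    "('i, 'm, 'n::finite) riemannian \<Rightarrow> ('m \<Rightarrow> real) \<Rightarrow> ('i, 'm, 'n) vfield set"
  where "wasserstein_tangent_space M \<rho> = {v \<in> L2_fields M \<rho>.
    \<forall>e>0. \<exists>f. smooth_function M f \<and>
      sqrt (L2_inner M \<rho> (v - gradient M f) (v - gradient M f)) < e}"


section \<open>Vector-valued kernels and their reproducing kernel Hilbert spaces\<close>

text \<open>\<open>k x y\<close> maps \<open>T\<^sub>xM\<close> to \<open>T\<^sub>yM\<close>; its values off \<open>T\<^sub>xM\<close> are irrelevant.  Positive definiteness is
  in the usual sense of kernel theory, with a non-strict inequality for the quadratic forms.\<close>

definition vector_kernel :: "('i, 'm, 'n::finite) riemannian \<Rightarrow> ('i, 'm, 'n) vkernel \<Rightarrow> bool"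
  where "vector_kernel M k \<longleftrightarrow>
    (\<forall>x y. \<forall>\<xi>\<in>tangent_space M x. k x y \<xi> \<in> tangent_space M y) \<and>
    (\<forall>x y. \<forall>\<xi>\<in>tangent_space M x. \<forall>\<eta>\<in>tangent_space M x. k x y (\<xi> + \<eta>) = k x y \<xi> + k x y \<eta>) \<and>
    (\<forall>x y c. \<forall>\<xi>\<in>tangent_space M x. k x y (c *\<^sub>R \<xi>) = c *\<^sub>R k x y \<xi>) \<and>
    (\<forall>x y. \<forall>\<xi>\<in>tangent_space M x. \<forall>\<eta>\<in>tangent_space M y.
       metric M y (k x y \<xi>) \<eta> = metric M x \<xi> (k y x \<eta>)) \<and>
    (\<forall>(N::nat) x \<xi>. (\<forall>a<N. \<xi> a \<in> tangent_space M (x a)) \<longrightarrow>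
       0 \<le> (\<Sum>a<N. \<Sum>b<N. metric M (x b) (k (x a) (x b) (\<xi> a)) (\<xi> b)))"

definition smooth_kernel :: "('i, 'm, 'n::finite) riemannian \<Rightarrow> ('i, 'm, 'n) vkernel \<Rightarrow> bool"
  where "smooth_kernel M k \<longleftrightarrow>
    (\<forall>i j b. smooth_on
       (\<lambda>(z, w). k (chart_inv M i z) (chart_inv M j w) (tvec_of_coords M i (chart_inv M i z) b) j)
       (chart_img M i \<times> chart_img M j))"

text \<open>The last conjunct, extending the inner product by 0 off \<open>H\<close>, only serves to make the pair
  \<open>(H, ip)\<close> unique.\<close>

definition is_rkhs ::
    "('i, 'm, 'n::finite) riemannian \<Rightarrow> ('i, 'm, 'n) vkernel \<Rightarrow> ('i, 'm, 'n) vfield set \<Rightarrow>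
      (('i, 'm, 'n) vfield \<Rightarrow> ('i, 'm, 'n) vfield \<Rightarrow> real) \<Rightarrow> bool"
  where "is_rkhs M k H ip \<longleftrightarrow>
    H \<subseteq> {v. vector_field M v} \<and> hilbert_space_on H ip \<and>
    (\<forall>x. \<forall>\<xi>\<in>tangent_space M x. (\<lambda>y. k x y \<xi>) \<in> H) \<and>
    (\<forall>v\<in>H. \<forall>x. \<forall>\<xi>\<in>tangent_space M x. ip v (\<lambda>y. k x y \<xi>) = metric M x (v x) \<xi>) \<and>
    (\<forall>u v. u \<notin> H \<or> v \<notin> H \<longrightarrow> ip u v = 0)"

definition rkhs ::
    "('i, 'm, 'n::finite) riemannian \<Rightarrow> ('i, 'm, 'n) vkernel \<Rightarrow>
      ('i, 'm, 'n) vfield set \<times> (('i, 'm, 'n) vfield \<Rightarrow> ('i, 'm, 'n) vfield \<Rightarrow> real)"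
  where "rkhs M k = (THE (H, ip). is_rkhs M k H ip)"

definition rkhs_space ::
    "('i, 'm, 'n::finite) riemannian \<Rightarrow> ('i, 'm, 'n) vkernel \<Rightarrow> ('i, 'm, 'n) vfield set"
  where "rkhs_space M k = fst (rkhs M k)"

definition rkhs_inner ::
    "('i, 'm, 'n::finite) riemannian \<Rightarrow> ('i, 'm, 'n) vkernel \<Rightarrow> ('i, 'm, 'n) vfield \<Rightarrow>
      ('i, 'm, 'n) vfield \<Rightarrow> real"
  where "rkhs_inner M k = snd (rkhs M k)"

definition finite_rank :: "('i, 'm, 'n::finite) riemannian \<Rightarrow> ('i, 'm, 'n) vkernel \<Rightarrow> bool"
  where "finite_rank M k \<longleftrightarrow> finite_dimensional (rkhs_space M k)"


section \<open>The operator \<open>S\<^sub>\<rho>\<close> and the law tangents\<close>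

definition incl :: "('i, 'm, 'n) vfield \<Rightarrow> ('i, 'm, 'n::finite) vfield"
  where "incl v = v"

definition incl_adjoint ::
    "('i, 'm, 'n::finite) riemannian \<Rightarrow> ('m \<Rightarrow> real) \<Rightarrow> ('i, 'm, 'n) vkernel \<Rightarrow>
      ('i, 'm, 'n) vfield \<Rightarrow> ('i, 'm, 'n) vfield"
  where "incl_adjoint M \<rho> k u = (THE w. w \<in> rkhs_space M k \<and>
    (\<forall>v\<in>rkhs_space M k. rkhs_inner M k v w = L2_inner M \<rho> (incl v) u))"

definition stein_operator ::
    "('i, 'm, 'n::finite) riemannian \<Rightarrow> ('m \<Rightarrow> real) \<Rightarrow> ('i, 'm, 'n) vkernel \<Rightarrow>
      ('i, 'm, 'n) vfield \<Rightarrow> ('i, 'm, 'n) vfield"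
  where "stein_operator M \<rho> k u = incl (incl_adjoint M \<rho> k u)"

definition law_operator ::
    "('i, 'm, 'n::finite) riemannian \<Rightarrow> ('m \<Rightarrow> real) \<Rightarrow> ('i, 'm, 'n) vfield \<Rightarrow> 'm \<Rightarrow> real"
  where "law_operator M \<rho> v = (\<lambda>p. - divergence M (\<lambda>q. \<rho> q *\<^sub>R v q) p)"

definition stein_law_tangent ::
    "('i, 'm, 'n::finite) riemannian \<Rightarrow> ('m \<Rightarrow> real) \<Rightarrow> ('i, 'm, 'n) vkernel \<Rightarrow>
      ('m \<Rightarrow> real) \<Rightarrow> 'm \<Rightarrow> real"
  where "stein_law_tangent M \<rho> k f = law_operator M \<rho> (stein_operator M \<rho> k (gradient M f))"

text \<open>The particle responses to a force \<open>u\<close>.\<close>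

definition otto_response :: "('i, 'm, 'n) vfield \<Rightarrow> ('i, 'm, 'n::finite) vfield"
  where "otto_response u = u"

definition stein_response ::
    "('i, 'm, 'n::finite) riemannian \<Rightarrow> ('m \<Rightarrow> real) \<Rightarrow> ('i, 'm, 'n) vkernel \<Rightarrow>
      ('i, 'm, 'n) vfield \<Rightarrow> ('i, 'm, 'n) vfield"
  where "stein_response M \<rho> k u = stein_operator M \<rho> k u"

text \<open>Linear maps \<open>R: E \<rightarrow> E\<close> that are self-adjoint and positive definite in \<open>L\<^sup>2(\<rho>;TM)\<close>.\<close>

definition pos_def_self_adjoint_on ::
    "('i, 'm, 'n::finite) riemannian \<Rightarrow> ('m \<Rightarrow> real) \<Rightarrow> ('i, 'm, 'n) vfield set \<Rightarrow>
      (('i, 'm, 'n) vfield \<Rightarrow> ('i, 'm, 'n) vfield) \<Rightarrow> bool"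
  where "pos_def_self_adjoint_on M \<rho> E R \<longleftrightarrow>
    (\<forall>u\<in>E. R u \<in> E) \<and>
    (\<forall>u\<in>E. \<forall>v\<in>E. R (u + v) = R u + R v) \<and>
    (\<forall>c. \<forall>u\<in>E. R (c *\<^sub>R u) = c *\<^sub>R R u) \<and>
    (\<forall>u\<in>E. \<forall>v\<in>E. L2_inner M \<rho> (R u) v = L2_inner M \<rho> u (R v)) \<and>
    (\<forall>u\<in>E. u \<noteq> 0 \<longrightarrow> L2_inner M \<rho> (R u) u > 0)"

text \<open>\<open>k\<close> is a smooth finite rank vector-valued kernel whose reproducing kernel Hilbert space is
  \<open>E\<close> as a vector space.\<close>

definition smooth_finite_rank_kernel_with_rkhs ::
    "('i, 'm, 'n::finite) riemannian \<Rightarrow> ('i, 'm, 'n) vkernel \<Rightarrow> ('i, 'm, 'n) vfield set \<Rightarrow> bool"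
  where "smooth_finite_rank_kernel_with_rkhs M k E \<longleftrightarrow>
    vector_kernel M k \<and> smooth_kernel M k \<and> finite_rank M k \<and>
    (\<exists>ip. is_rkhs M k E ip) \<and> rkhs_space M k = E"

end

theory Submission
  imports Defs
begin

text \<open>
  A finite-dimensional space \<open>E\<close> of vector fields with an inner product has the reproducing kernel
  \<open>k(x,y) \<xi> = \<Sum>\<^sub>e \<langle>e(x), \<xi>\<rangle> e(y)\<close>, summed over an orthonormal basis, and the kernel is smooth when
  the fields are.  Realizing \<open>R\<close> is therefore only a matter of choosing the inner product on \<open>E\<close>.
  Since \<open>S\<^sub>\<rho> u\<close> is the representer in \<open>E\<close> of the functional \<open>v \<mapsto> \<langle>v, u\<rangle>\<close> on \<open>L\<^sup>2(\<rho>)\<close>, the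
  requirement \<open>S\<^sub>\<rho> u = R u\<close> reads \<open>\<langle>v, R u\<rangle>\<^sub>E = \<langle>v, u\<rangle>\<close> for all \<open>u, v \<in> E\<close>; that is, the inner product
  has to be \<open>\<langle>v, w\<rangle>\<^sub>E = \<langle>v, R\<^sup>-\<^sup>1 w\<rangle>\<close>.

  The inverse of \<open>R\<close> need not be formed.  If \<open>B\<close> is a basis of \<open>E\<close> orthonormal for
  \<open>\<langle>R u, v\<rangle>\<close>, then \<open>R\<^sup>-\<^sup>1 w = \<Sum>\<^sub>b \<langle>w, b\<rangle> b\<close>, so \<open>\<langle>v, w\<rangle>\<^sub>E = \<Sum>\<^sub>b \<langle>v, b\<rangle> \<langle>w, b\<rangle>\<close>, an expression that is
  visibly bilinear and symmetric, and definite because \<open>B\<close> spans \<open>E\<close> (\<open>dual_inner_product\<close>).  The kernel itself is built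
  in \<open>kernel_with_rkhs_exists\<close>, and \<open>rkhs_eqI\<close> shows that a finite-dimensional reproducing kernel
  Hilbert space is the only one of its kernel.

  Two facts about the manifold enter.  The \<open>L\<^sup>2(\<rho>)\<close> form is definite on smooth fields,
  because a nonzero continuous field is nonzero on a nonempty open set and such a set has positive
  volume (\<open>open_volume_pos\<close>); this rests on the positivity of the Gram determinants.  The kernel
  is smooth in charts because the metric is a polynomial in the components of the fields and in the
  entries of the Gram matrix (\<open>metric_in_chart\<close>).
\<close>

lemma sum_fun_apply: "(\<Sum>a\<in>A. f a) x = (\<Sum>a\<in>A. f a x)"
  by (induction A rule: infinite_finite_induct) auto

section \<open>Finite-dimensional inner product spaces\<close>

text \<open>Three kinds of inner product occur on fields: the metric on a tangent space, the \<open>L\<^sup>2\<close> product on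
  \<open>E\<close>, and the product of a reproducing kernel Hilbert space.  The locale serves all of
  them.\<close>

locale inner_product_carrier =
  fixes V :: "'v::real_vector set" and ip :: "'v \<Rightarrow> 'v \<Rightarrow> real"
  assumes subspace_carrier: "subspace V"
    and inner_product: "inner_product_on V ip"
begin

lemma commute: "u \<in> V \<Longrightarrow> v \<in> V \<Longrightarrow> ip u v = ip v u"
  using inner_product by (simp add: inner_product_on_def)

lemma add_left: "u \<in> V \<Longrightarrow> v \<in> V \<Longrightarrow> w \<in> V \<Longrightarrow> ip (u + v) w = ip u w + ip v w"
  using inner_product by (simp add: inner_product_on_def)

lemma scale_left: "u \<in> V \<Longrightarrow> v \<in> V \<Longrightarrow> ip (c *\<^sub>R u) v = c * ip u v"
  using inner_product by (simp add: inner_product_on_def)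

lemma positive: "u \<in> V \<Longrightarrow> u \<noteq> 0 \<Longrightarrow> ip u u > 0"
  using inner_product by (simp add: inner_product_on_def)

lemma add_right: "u \<in> V \<Longrightarrow> v \<in> V \<Longrightarrow> w \<in> V \<Longrightarrow> ip w (u + v) = ip w u + ip w v"
  using add_left[of u v w] commute subspace_add[OF subspace_carrier] by metis

lemma scale_right: "u \<in> V \<Longrightarrow> v \<in> V \<Longrightarrow> ip v (c *\<^sub>R u) = c * ip v u"
  using scale_left[of u v c] commute subspace_scale[OF subspace_carrier] by metis

lemma zero_left: "v \<in> V \<Longrightarrow> ip 0 v = 0"
  using scale_left[of 0 v 0] subspace_0[OF subspace_carrier] by simp

lemma zero_right: "v \<in> V \<Longrightarrow> ip v 0 = 0"
  using zero_left commute subspace_0[OF subspace_carrier] by metis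

lemma diff_left: "u \<in> V \<Longrightarrow> v \<in> V \<Longrightarrow> w \<in> V \<Longrightarrow> ip (u - v) w = ip u w - ip v w"
  using add_left[of u "- v" w] scale_left[of v w "-1"] subspace_neg[OF subspace_carrier] by simp

lemma sum_left:
  assumes "\<And>a. a \<in> A \<Longrightarrow> f a \<in> V" "v \<in> V"
  shows "ip (\<Sum>a\<in>A. f a) v = (\<Sum>a\<in>A. ip (f a) v)"
proof (cases "finite A")
  case True
  then show ?thesis using assms(1)
  proof (induction A)
    case empty
    then show ?case using zero_left[OF assms(2)] by simp
  next
    case (insert a A)
    have "sum f A \<in> V" using insert by (intro subspace_sum[OF subspace_carrier]) auto
    then show ?case using insert assms(2) by (simp add: add_left)
  qed
qed (simp add: zero_left[OF assms(2)])

lemma sum_right: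
  assumes "\<And>a. a \<in> A \<Longrightarrow> f a \<in> V" "v \<in> V"
  shows "ip v (\<Sum>a\<in>A. f a) = (\<Sum>a\<in>A. ip v (f a))"
proof -
  have "sum f A \<in> V" using assms(1) by (intro subspace_sum[OF subspace_carrier]) auto
  then have "ip v (sum f A) = ip (sum f A) v" using commute assms(2) by simp
  also have "\<dots> = (\<Sum>a\<in>A. ip (f a) v)" by (rule sum_left[OF assms])
  also have "\<dots> = (\<Sum>a\<in>A. ip v (f a))"
    using assms commute by (intro sum.cong) auto
  finally show ?thesis .
qed

lemma nonneg: "u \<in> V \<Longrightarrow> ip u u \<ge> 0"
  using positive[of u] zero_left[of u] by (cases "u = 0") auto

lemma eq_0_iff: "u \<in> V \<Longrightarrow> ip u u = 0 \<longleftrightarrow> u = 0"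
  using positive[of u] zero_left[of u] by (cases "u = 0") auto

lemma orthogonal_span:
  assumes "B \<subseteq> V" "r \<in> V" "\<And>e. e \<in> B \<Longrightarrow> ip r e = 0" "w \<in> span B"
  shows "ip r w = 0"
proof -
  have "w \<in> V \<and> ip r w = 0"
  proof (rule span_induct[OF assms(4)])
    show "subspace {w. w \<in> V \<and> ip r w = 0}"
      unfolding subspace_def using subspace_carrier assms(2)
      by (auto simp: subspace_0 subspace_add subspace_scale zero_right add_right scale_right)
  qed (use assms in auto)
  then show ?thesis by simp
qed

definition orthonormal :: "'v set \<Rightarrow> bool"
  where "orthonormal B \<longleftrightarrow> finite B \<and> B \<subseteq> V \<and>
    (\<forall>e\<in>B. \<forall>e'\<in>B. ip e e' = (if e = e' then 1 else 0))"

definition projection :: "'v set \<Rightarrow> 'v \<Rightarrow> 'v"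
  where "projection B v = (\<Sum>e\<in>B. ip v e *\<^sub>R e)"

lemma projection_in_span: "projection B v \<in> span B"
  unfolding projection_def by (intro span_sum span_scale span_base)

lemma span_carrier: "B \<subseteq> V \<Longrightarrow> span B \<subseteq> V"
  using span_minimal subspace_carrier by blast

lemma inner_combination:
  assumes "orthonormal B" "e \<in> B"
  shows "ip (\<Sum>e\<in>B. c e *\<^sub>R e) e = c e"
proof -
  have "ip (\<Sum>e\<in>B. c e *\<^sub>R e) e = (\<Sum>e'\<in>B. c e' * (if e' = e then 1 else 0))"
    using assms subspace_scale[OF subspace_carrier] unfolding orthonormal_def
    by (subst sum_left) (auto simp: scale_left subset_iff intro!: sum.cong)
  also have "\<dots> = c e" using assms by (simp add: orthonormal_def if_distrib cong: if_cong)
  finally show ?thesis .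
qed

lemma residual_orthogonal:
  assumes "orthonormal B" "v \<in> V" "w \<in> span B"
  shows "ip (v - projection B v) w = 0"
proof (rule orthogonal_span[OF _ _ _ assms(3)])
  show B: "B \<subseteq> V" using assms by (simp add: orthonormal_def)
  have p: "projection B v \<in> V" using projection_in_span span_carrier[OF B] by blast
  show "v - projection B v \<in> V" using subspace_diff[OF subspace_carrier] assms p by simp
  show "ip (v - projection B v) e = 0" if "e \<in> B" for e
    using inner_combination[OF assms(1) that, of "ip v"] diff_left[OF assms(2) p, of e] that B
    by (auto simp: projection_def)
qed

lemma projection_span:
  assumes "orthonormal B" "v \<in> span B"
  shows "projection B v = v"
proof -
  have B: "B \<subseteq> V" using assms by (simp add: orthonormal_def)
  then have v: "v \<in> V" using assms span_carrier by blast
  have r: "v - projection B v \<in> span B" using assms projection_in_span span_diff by blast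
  have "ip (v - projection B v) (v - projection B v) = 0"
    by (rule residual_orthogonal[OF assms(1) v r])
  then show ?thesis using r eq_0_iff span_carrier[OF B] by auto
qed

lemma gram_schmidt:
  assumes "finite A" "A \<subseteq> V"
  shows "\<exists>B. orthonormal B \<and> span B = span A"
  using assms
proof (induction A)
  case empty
  then show ?case by (intro exI[of _ "{}"]) (simp add: orthonormal_def)
next
  case (insert a A)
  then obtain B where B: "orthonormal B" "span B = span A" by auto
  have BV: "B \<subseteq> V" and fin: "finite B" using B by (auto simp: orthonormal_def)
  have a: "a \<in> V" using insert by simp
  define r where "r = a - projection B a"
  have pV: "projection B a \<in> V" using projection_in_span span_carrier[OF BV] by blast
  have rV: "r \<in> V" unfolding r_def using subspace_diff[OF subspace_carrier a pV] .
  show ?case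
  proof (cases "r = 0")
    case True
    then have "a \<in> span A" using projection_in_span[of B a] B by (simp add: r_def)
    then show ?thesis using B by (auto simp: span_redundant)
  next
    case False
    define n where "n = sqrt (ip r r)"
    have n: "n > 0" "n * n = ip r r" using positive[OF rV False] by (simp_all add: n_def)
    define e where "e = (1/n) *\<^sub>R r"
    have eV: "e \<in> V" unfolding e_def using subspace_scale[OF subspace_carrier rV] .
    have e_orth: "ip e b = 0" "ip b e = 0" if "b \<in> B" for b
    proof -
      have "b \<in> V" using that BV by auto
      moreover have "ip r b = 0"
        unfolding r_def by (rule residual_orthogonal[OF B(1) a span_base[OF that]])
      ultimately show "ip e b = 0" "ip b e = 0"
        using rV eV commute[of b e] by (auto simp: e_def scale_left)
    qed
    have e1: "ip e e = 1"
      using rV n eV unfolding e_def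
      by (simp add: scale_left scale_right subspace_scale[OF subspace_carrier])
         (metis less_irrefl mult_pos_pos right_inverse mult.assoc inverse_mult_distrib inverse_eq_divide)
    have "orthonormal (insert e B)"
      using B(1) eV e_orth e1 unfolding orthonormal_def by auto
    moreover have "span (insert e B) = span (insert a A)"
    proof -
      have ra: "r = a + (- projection B a)" by (simp add: r_def)
      have "a = n *\<^sub>R e + projection B a" using n by (simp add: e_def r_def)
      moreover have "projection B a \<in> span (insert e B)"
        using projection_in_span span_mono[of B "insert e B"] by blast
      ultimately have "a \<in> span (insert e B)"
        by (metis span_add span_scale span_base insertI1)
      moreover have "A \<subseteq> span (insert e B)"
        using B(2) span_superset[of A] span_mono[of B "insert e B"] by blast
      moreover have "e \<in> span (insert a A)"
      proof -
        have "projection B a \<in> span (insert a A)"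
          using projection_in_span[of B a] B(2) span_mono[of A "insert a A"] by blast
        then show ?thesis
          unfolding e_def r_def by (intro span_scale span_diff) (auto intro: span_base)
      qed
      moreover have "B \<subseteq> span (insert a A)"
        using B(2) span_superset[of B] span_mono[of A "insert a A"] by blast
      ultimately show ?thesis
        by (intro antisym span_minimal subspace_span) auto
    qed
    ultimately show ?thesis by blast
  qed
qed

text \<open>The basis is orthonormal for the inner product of the ambient space \<open>V\<close>, which may be
  infinite dimensional; this allows projecting from \<open>V\<close> onto \<open>W\<close>.\<close>

lemma orthonormal_basis_exists:
  assumes "finite_dimensional W" "W \<subseteq> V"
  obtains B where "orthonormal B" "span B = W"
proof -
  obtain A where "finite A" "W = span A" using assms by (auto simp: finite_dimensional_def)
  then show ?thesis using gram_schmidt[of A] assms(2) span_superset[of A] that by auto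
qed

lemma parseval:
  assumes "orthonormal B" "u \<in> V" "v \<in> span B"
  shows "ip u v = (\<Sum>e\<in>B. ip u e * ip v e)"
proof -
  have B: "B \<subseteq> V" using assms by (simp add: orthonormal_def)
  have "ip u v = ip u (\<Sum>e\<in>B. ip v e *\<^sub>R e)"
    using projection_span[OF assms(1,3)] by (simp add: projection_def)
  also have "\<dots> = (\<Sum>e\<in>B. ip u (ip v e *\<^sub>R e))"
    using B assms(2) subspace_scale[OF subspace_carrier] by (intro sum_right) auto
  also have "\<dots> = (\<Sum>e\<in>B. ip u e * ip v e)"
    using B assms(2) by (intro sum.cong) (auto simp: scale_right)
  finally show ?thesis .
qed

text \<open>In orthonormal coordinates a Cauchy sequence is Cauchy in each of finitely many components,
  and the componentwise limits assemble to the limit.\<close>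

lemma finite_dimensional_complete:
  assumes fd: "finite_dimensional V"
  shows "hilbert_space_on V ip"
  unfolding hilbert_space_on_def
proof (intro conjI subspace_carrier inner_product allI impI)
  obtain B where B: "orthonormal B" "span B = V" using orthonormal_basis_exists[OF fd] by auto
  have BV: "B \<subseteq> V" and fin: "finite B" using B by (auto simp: orthonormal_def)
  have norm: "ip u u = (\<Sum>e\<in>B. (ip u e)\<^sup>2)" if "u \<in> V" for u
    using parseval[OF B(1) that, of u] that B by (simp add: power2_eq_square)
  fix X :: "nat \<Rightarrow> 'v"
  assume "(\<forall>n. X n \<in> V) \<and>
    (\<forall>e>0. \<exists>N. \<forall>m\<ge>N. \<forall>n\<ge>N. ip (X m - X n) (X m - X n) < e)"
  then have XV: "\<And>n. X n \<in> V"
    and cau: "\<And>e. e > 0 \<Longrightarrow> \<exists>N. \<forall>m\<ge>N. \<forall>n\<ge>N. ip (X m - X n) (X m - X n) < e" by auto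
  have "convergent (\<lambda>n. ip (X n) e)" if e: "e \<in> B" for e
  proof (rule Cauchy_convergent, rule metric_CauchyI)
    fix \<epsilon> :: real assume "\<epsilon> > 0"
    then obtain N where N: "\<And>m n. m \<ge> N \<Longrightarrow> n \<ge> N \<Longrightarrow> ip (X m - X n) (X m - X n) < \<epsilon>\<^sup>2"
      using cau[of "\<epsilon>\<^sup>2"] by auto
    have "dist (ip (X m) e) (ip (X n) e) < \<epsilon>" if "m \<ge> N" "n \<ge> N" for m n
    proof -
      have d: "X m - X n \<in> V" using subspace_diff[OF subspace_carrier] XV by simp
      have "(ip (X m - X n) e)\<^sup>2 \<le> (\<Sum>e\<in>B. (ip (X m - X n) e)\<^sup>2)"
        using e fin by (intro member_le_sum) auto
      also have "\<dots> < \<epsilon>\<^sup>2" using N[OF that] norm[OF d] by simp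
      finally have "\<bar>ip (X m - X n) e\<bar> < \<epsilon>"
        using \<open>\<epsilon> > 0\<close> by (metis abs_le_square_iff abs_of_pos linorder_not_less)
      then show ?thesis using diff_left[OF XV XV] e BV by (auto simp: dist_real_def)
    qed
    then show "\<exists>N. \<forall>m\<ge>N. \<forall>n\<ge>N. dist (ip (X m) e) (ip (X n) e) < \<epsilon>" by blast
  qed
  then have "\<forall>e\<in>B. \<exists>l. (\<lambda>n. ip (X n) e) \<longlonglongrightarrow> l" by (simp add: convergent_def)
  then obtain c where c: "\<And>e. e \<in> B \<Longrightarrow> (\<lambda>n. ip (X n) e) \<longlonglongrightarrow> c e" by metis
  define v where "v = (\<Sum>e\<in>B. c e *\<^sub>R e)"
  have vV: "v \<in> V"
    unfolding v_def using BV by (intro subspace_sum subspace_scale subspace_carrier) auto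
  have "ip (X n - v) (X n - v) = (\<Sum>e\<in>B. (ip (X n) e - c e)\<^sup>2)" for n
  proof -
    have "ip (X n - v) e = ip (X n) e - c e" if "e \<in> B" for e
      using diff_left[OF XV vV] inner_combination[OF B(1) that, of c] that BV
      by (auto simp: v_def)
    then show ?thesis using norm[OF subspace_diff[OF subspace_carrier XV vV]] by simp
  qed
  moreover have "(\<lambda>n. \<Sum>e\<in>B. (ip (X n) e - c e)\<^sup>2) \<longlonglongrightarrow> (\<Sum>e\<in>B. (c e - c e)\<^sup>2)"
    using c by (intro tendsto_intros) auto
  ultimately have "(\<lambda>n. ip (X n - v) (X n - v)) \<longlonglongrightarrow> 0" by simp
  then show "\<exists>v\<in>V. (\<lambda>n. ip (X n - v) (X n - v)) \<longlonglongrightarrow> 0"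
    using vV by blast
qed

text \<open>The form \<open>ip'\<close> is \<open>(u, v) \<mapsto> ip (R\<^sup>-\<^sup>1 u) v\<close>.  It is obtained from a basis \<open>B\<close> that is
  orthonormal for \<open>ip (R u) v\<close>: the expansion \<open>u = \<Sum>\<^sub>b ip (R u) b *\<^sub>R b\<close> shows that
  \<open>w \<mapsto> \<Sum>\<^sub>b ip w b *\<^sub>R b\<close> inverts \<open>R\<close>.\<close>

lemma dual_inner_product:
  assumes fd: "finite_dimensional V"
    and R: "\<And>u. u \<in> V \<Longrightarrow> R u \<in> V"
      "\<And>u v. u \<in> V \<Longrightarrow> v \<in> V \<Longrightarrow> R (u + v) = R u + R v"
      "\<And>c u. u \<in> V \<Longrightarrow> R (c *\<^sub>R u) = c *\<^sub>R R u"
      "\<And>u v. u \<in> V \<Longrightarrow> v \<in> V \<Longrightarrow> ip (R u) v = ip u (R v)"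
      "\<And>u. u \<in> V \<Longrightarrow> u \<noteq> 0 \<Longrightarrow> ip (R u) u > 0"
  obtains ip' where "inner_product_on V ip'"
    "\<And>u v. u \<in> V \<Longrightarrow> v \<in> V \<Longrightarrow> ip' v (R u) = ip v u"
proof -
  interpret Q: inner_product_carrier V "\<lambda>u v. ip (R u) v"
  proof
    show "subspace V" by (rule subspace_carrier)
    show "inner_product_on V (\<lambda>u v. ip (R u) v)"
      unfolding inner_product_on_def using R
      by (auto simp: add_left scale_left) (metis commute)
  qed
  obtain B where B: "Q.orthonormal B" "span B = V"
    using Q.orthonormal_basis_exists[OF fd] by auto
  have BV: "B \<subseteq> V" and fin: "finite B" using B by (auto simp: Q.orthonormal_def)
  define ip' where "ip' u v = (\<Sum>b\<in>B. ip u b * ip v b)" for u v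
  have pos: "ip' u u > 0" if u: "u \<in> V" "u \<noteq> 0" for u
  proof -
    have "\<not> (\<forall>b\<in>B. ip u b = 0)"
      using orthogonal_span[OF BV u(1), of u] eq_0_iff[OF u(1)] u B(2) by auto
    then obtain b where "b \<in> B" "ip u b \<noteq> 0" by auto
    then show ?thesis
      unfolding ip'_def using fin by (intro sum_pos2[of _ b]) (auto simp: less_le)
  qed
  have "inner_product_on V ip'"
    unfolding inner_product_on_def
  proof (intro conjI ballI allI impI)
    show "ip' u v = ip' v u" for u v by (simp add: ip'_def mult.commute)
    show "ip' (u + v) w = ip' u w + ip' v w" if "u \<in> V" "v \<in> V" "w \<in> V" for u v w
      unfolding ip'_def sum.distrib[symmetric] using that BV
      by (intro sum.cong) (auto simp: add_left subset_iff distrib_right)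
    show "ip' (c *\<^sub>R u) v = c * ip' u v" if "u \<in> V" "v \<in> V" for c u v
      unfolding ip'_def sum_distrib_left using that BV
      by (intro sum.cong) (auto simp: scale_left subset_iff)
  qed (use pos in auto)
  moreover have "ip' v (R u) = ip v u" if "u \<in> V" "v \<in> V" for u v
  proof -
    have "ip v u = ip v (\<Sum>b\<in>B. ip (R u) b *\<^sub>R b)"
      using Q.projection_span[OF B(1), of u] that B(2) by (simp add: Q.projection_def)
    also have "\<dots> = (\<Sum>b\<in>B. ip v (ip (R u) b *\<^sub>R b))"
      using BV that subspace_scale[OF subspace_carrier] by (intro sum_right) auto
    also have "\<dots> = ip' v (R u)"
      unfolding ip'_def using BV that by (intro sum.cong) (auto simp: scale_right)
    finally show ?thesis by simp
  qed
  ultimately show thesis using that by blast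
qed

end

section \<open>Calculus of smooth maps\<close>

text \<open>The predicate \<^const>\<open>Ck_on\<close> refers to the Frechet derivative at each point of \<open>S\<close>, taken in
  the full space.  On open sets it therefore depends only on the values in \<open>S\<close>, and any explicit
  derivative may be used to step from \<open>k\<close> to \<open>Suc k\<close>.\<close>

lemma Ck_on_cong:
  assumes "open S" "\<And>x. x \<in> S \<Longrightarrow> f x = g x" "Ck_on k f S"
  shows "Ck_on k g S"
  using assms(2,3)
proof (induction k arbitrary: f g)
  case 0
  then show ?case using continuous_on_cong[of S S f g] by simp
next
  case (Suc k)
  have der: "(g has_derivative frechet_derivative f (at x)) (at x)" if "x \<in> S" for x
    using Suc.prems that assms(1)
    by (intro has_derivative_transform_within_open[of f _ x UNIV S g])
       (auto simp: frechet_derivative_works)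
  have "Ck_on k (\<lambda>x. frechet_derivative g (at x) v) S" for v
  proof (rule Suc.IH)
    show "Ck_on k (\<lambda>x. frechet_derivative f (at x) v) S" using Suc.prems by simp
    show "frechet_derivative f (at x) v = frechet_derivative g (at x) v" if "x \<in> S" for x
      using frechet_derivative_at[OF der[OF that]] by simp
  qed
  then show ?case using der by (auto simp: differentiable_def)
qed

lemma Ck_on_SucI:
  assumes "open S" "\<And>x. x \<in> S \<Longrightarrow> (f has_derivative f' x) (at x)"
    and "\<And>v. Ck_on k (\<lambda>x. f' x v) S"
  shows "Ck_on (Suc k) f S"
proof -
  have "Ck_on k (\<lambda>x. frechet_derivative f (at x) v) S" for v
    by (rule Ck_on_cong[OF assms(1) _ assms(3)[of v]])
       (use frechet_derivative_at[OF assms(2)] in auto)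
  then show ?thesis using assms(2) by (auto simp: differentiable_def)
qed

lemma Ck_on_SucD: "Ck_on (Suc k) f S \<Longrightarrow> Ck_on k f S"
proof (induction k arbitrary: f)
  case 0
  then show ?case
    by (auto intro!: continuous_at_imp_continuous_on differentiable_imp_continuous_within)
qed auto

lemma Ck_on_has_derivative:
  "Ck_on (Suc k) f S \<Longrightarrow> x \<in> S \<Longrightarrow> (f has_derivative frechet_derivative f (at x)) (at x)"
  by (simp add: frechet_derivative_works)

lemma Ck_on_const: "open S \<Longrightarrow> Ck_on k (\<lambda>x. c) S"
proof (induction k arbitrary: c)
  case (Suc k)
  show ?case by (rule Ck_on_SucI[where f' = "\<lambda>x v. 0"]) (use Suc in auto)
qed simp

lemma Ck_on_add:
  assumes "open S" "Ck_on k f S" "Ck_on k g S"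
  shows "Ck_on k (\<lambda>x. f x + g x) S"
  using assms(2,3)
proof (induction k arbitrary: f g)
  case (Suc k)
  show ?case
    by (rule Ck_on_SucI[OF assms(1) has_derivative_add[OF Ck_on_has_derivative[OF Suc.prems(1)]
            Ck_on_has_derivative[OF Suc.prems(2)]]])
       (use Suc in auto)
qed (auto intro: continuous_intros)

lemma (in bounded_bilinear) Ck_on_product:
  fixes f :: "'d::euclidean_space \<Rightarrow> 'a" and g :: "'d \<Rightarrow> 'b"
  assumes "open S" "Ck_on k f S" "Ck_on k g S"
  shows "Ck_on k (\<lambda>x. prod (f x) (g x)) S"
  using assms(2,3)
proof (induction k arbitrary: f g)
  case 0
  then show ?case by (simp add: continuous_on)
next
  case (Suc k)
  show ?case
  proof (rule Ck_on_SucI[OF assms(1) FDERIV[OF Ck_on_has_derivative[OF Suc.prems(1)]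
            Ck_on_has_derivative[OF Suc.prems(2)]]])
    fix v
    show "Ck_on k (\<lambda>x. prod (f x) (frechet_derivative g (at x) v) +
        prod (frechet_derivative f (at x) v) (g x)) S"
      using Suc.prems by (intro Ck_on_add[OF assms(1)] Suc.IH Ck_on_SucD[of k f] Ck_on_SucD[of k g]) auto
  qed
qed

lemma Ck_on_compose_linear:
  fixes L :: "'a::euclidean_space \<Rightarrow> 'b::euclidean_space"
  assumes "open S" "open T" "bounded_linear L" "\<And>x. x \<in> T \<Longrightarrow> L x \<in> S" "Ck_on k f S"
  shows "Ck_on k (\<lambda>x. f (L x)) T"
  using assms(5)
proof (induction k arbitrary: f)
  case 0
  have "continuous_on T L" using assms(3) by (simp add: linear_continuous_on)
  then show ?case using 0 assms(4) by (auto intro: continuous_on_compose2)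
next
  case (Suc k)
  show ?case
  proof (rule Ck_on_SucI[OF assms(2)])
    show "((\<lambda>x. f (L x)) has_derivative (\<lambda>v. frechet_derivative f (at (L x)) (L v))) (at x)"
      if "x \<in> T" for x
      using has_derivative_compose[OF bounded_linear_imp_has_derivative[OF assms(3)]
          Ck_on_has_derivative[OF Suc.prems assms(4)[OF that]]] .
    show "Ck_on k (\<lambda>x. frechet_derivative f (at (L x)) (L v)) T" for v
      using Suc.prems by (intro Suc.IH) simp
  qed
qed

lemma smooth_on_cong:
  "open S \<Longrightarrow> (\<And>x. x \<in> S \<Longrightarrow> f x = g x) \<Longrightarrow> smooth_on f S \<Longrightarrow> smooth_on g S"
  using Ck_on_cong unfolding smooth_on_def by blast

lemma smooth_on_const: "open S \<Longrightarrow> smooth_on (\<lambda>x. c) S"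
  by (simp add: smooth_on_def Ck_on_const)

lemma smooth_on_sum:
  "open S \<Longrightarrow> (\<And>a. a \<in> A \<Longrightarrow> smooth_on (f a) S) \<Longrightarrow> smooth_on (\<lambda>x. \<Sum>a\<in>A. f a x) S"
  by (induction A rule: infinite_finite_induct)
     (auto simp: smooth_on_def Ck_on_const intro!: Ck_on_add)

lemma smooth_on_scaleR:
  "open S \<Longrightarrow> smooth_on f S \<Longrightarrow> smooth_on g S \<Longrightarrow> smooth_on (\<lambda>x. f x *\<^sub>R g x) S"
  by (simp add: smooth_on_def bounded_bilinear.Ck_on_product[OF bounded_bilinear_scaleR])

lemma smooth_on_inner:
  "open S \<Longrightarrow> smooth_on f S \<Longrightarrow> smooth_on g S \<Longrightarrow> smooth_on (\<lambda>x. f x \<bullet> g x) S"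
  by (simp add: smooth_on_def bounded_bilinear.Ck_on_product[OF bounded_bilinear_inner])

lemma smooth_on_compose_linear:
  fixes L :: "'a::euclidean_space \<Rightarrow> 'b::euclidean_space"
  assumes "open S" "open T" "bounded_linear L" "\<And>x. x \<in> T \<Longrightarrow> L x \<in> S" "smooth_on f S"
  shows "smooth_on (\<lambda>x. f (L x)) T"
  using assms Ck_on_compose_linear unfolding smooth_on_def by blast

lemma smooth_on_imp_continuous_on: "smooth_on f S \<Longrightarrow> continuous_on S f"
  unfolding smooth_on_def using Ck_on.simps(1) by blast

lemma smooth_on_has_derivative:
  "smooth_on f S \<Longrightarrow> x \<in> S \<Longrightarrow> (f has_derivative frechet_derivative f (at x)) (at x)"
  unfolding smooth_on_def using Ck_on_has_derivative by blast


section \<open>Charts, tangent vectors and volume\<close>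

text \<open>The matrices on the segment from the identity to \<open>G\<close> are all positive definite, hence invertible,
  so the determinant keeps the sign that it has at the identity.\<close>

lemma det_pos_if_positive_definite:
  fixes G :: "real ^ 'n ^ 'n"
  assumes pos: "\<And>b. b \<noteq> 0 \<Longrightarrow> 0 < b \<bullet> (G *v b)"
  shows "det G > 0"
proof (rule ccontr)
  assume neg: "\<not> det G > 0"
  define P :: "real \<Rightarrow> real ^ 'n ^ 'n" where "P t = (1 - t) *\<^sub>R mat 1 + t *\<^sub>R G" for t
  have quad: "b \<bullet> (P t *v b) = (1 - t) * (b \<bullet> b) + t * (b \<bullet> (G *v b))" for t b
    by (simp add: P_def matrix_vector_mult_add_rdistrib scaleR_matrix_vector_assoc[symmetric]
        inner_add_right)
  have nz: "det (P t) \<noteq> 0" if t: "0 \<le> t" "t \<le> 1" for t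
  proof -
    have "b = 0" if "P t *v b = 0" for b
    proof (rule ccontr)
      assume b: "b \<noteq> 0"
      have "(1 - t) * (b \<bullet> b) + t * (b \<bullet> (G *v b)) > 0"
      proof (cases "t = 0")
        case False
        then show ?thesis using t pos[OF b] by (intro add_nonneg_pos) auto
      qed (use b in simp)
      then show False using quad[of b t] that by simp
    qed
    then have "invertible (P t)"
      by (metis invertible_left_inverse matrix_left_invertible_ker)
    then show ?thesis by (simp add: invertible_det_nz)
  qed
  have "continuous_on {0..1} (\<lambda>t. det (P t))"
    unfolding det_def P_def by (intro continuous_intros)
  moreover have "det (P 0) = 1" "det (P 1) = det G" by (simp_all add: P_def)
  ultimately obtain t where "0 \<le> t" "t \<le> 1" "det (P t) = 0"
    using IVT2'[of "\<lambda>t. det (P t)" 1 0 0] neg by auto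
  then show False using nz by blast
qed

locale riemannian_manifold =
  fixes M :: "('i, 'm::{t2_space, second_countable_topology}, 'n::finite) riemannian"
  assumes atlas: "oriented_smooth_atlas M"
    and metric: "riemannian_metric M"
begin

lemma open_chart_dom: "open (chart_dom M i)"
  and open_chart_img: "open (chart_img M i)"
  and chart_homeomorphism:
    "homeomorphism (chart_dom M i) (chart_img M i) (chart_map M i) (chart_inv M i)"
  using atlas by (auto simp: oriented_smooth_atlas_def)

lemma chart_inv_map: "p \<in> chart_dom M i \<Longrightarrow> chart_inv M i (chart_map M i p) = p"
  using homeomorphism_apply1[OF chart_homeomorphism] .

lemma chart_inv_in_dom: "y \<in> chart_img M i \<Longrightarrow> chart_inv M i y \<in> chart_dom M i"
  using homeomorphism_image2[OF chart_homeomorphism[of i]] by blast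

lemma chart_map_in_img: "p \<in> chart_dom M i \<Longrightarrow> chart_map M i p \<in> chart_img M i"
  by (simp add: chart_img_def)

lemma open_chart_image:
  assumes "open A" "A \<subseteq> chart_dom M i"
  shows "open (chart_map M i ` A)"
proof -
  have "openin (top_of_set (chart_dom M i)) A" using assms open_subset by blast
  then have "openin (top_of_set (chart_img M i)) (chart_map M i ` A)"
    by (rule homeomorphism_imp_open_map[OF chart_homeomorphism])
  then show ?thesis using openin_open_trans open_chart_img by blast
qed

lemma open_chart_preimage:
  assumes "open W"
  shows "open {p \<in> chart_dom M i. chart_map M i p \<in> W}"
proof -
  have "continuous_on (chart_dom M i) (chart_map M i)"
    using chart_homeomorphism homeomorphism_cont1 by blast
  then have "open (chart_dom M i \<inter> chart_map M i -` W)"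
    using assms open_chart_dom continuous_open_preimage by blast
  then show ?thesis by (simp add: vimage_def Int_def)
qed

lemma transition_chart_map:
  "p \<in> chart_dom M i \<Longrightarrow> transition M i j (chart_map M i p) = chart_map M j p"
  by (simp add: transition_def chart_inv_map)

lemma transition_has_derivative:
  assumes "p \<in> chart_dom M i" "p \<in> chart_dom M j"
  shows "(transition M i j has_derivative jacobian M i j p) (at (chart_map M i p))"
  unfolding jacobian_def
  by (rule smooth_on_has_derivative[of _ "chart_map M i ` (chart_dom M i \<inter> chart_dom M j)"])
     (use atlas assms in \<open>auto simp: oriented_smooth_atlas_def\<close>)

lemma linear_jacobian:
  "p \<in> chart_dom M i \<Longrightarrow> p \<in> chart_dom M j \<Longrightarrow> linear (jacobian M i j p)"
  using transition_has_derivative has_derivative_linear by blast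

text \<open>The chain rule for transition maps.  It makes \<^const>\<open>tvec_of_coords\<close> produce tangent vectors,
  and so identifies each tangent space with the coordinate space of any chart.\<close>

lemma jacobian_cocycle:
  assumes p: "p \<in> chart_dom M i" "p \<in> chart_dom M j" "p \<in> chart_dom M k"
  shows "jacobian M j k p (jacobian M i j p b) = jacobian M i k p b"
proof -
  let ?W = "chart_map M i ` (chart_dom M i \<inter> chart_dom M j)"
  have "((transition M j k \<circ> transition M i j) has_derivative
      (jacobian M j k p \<circ> jacobian M i j p)) (at (chart_map M i p))"
    using p by (intro diff_chain_at)
      (simp_all add: transition_has_derivative transition_chart_map)
  then have "(transition M i k has_derivative (jacobian M j k p \<circ> jacobian M i j p))
      (at (chart_map M i p))"
  proof (rule has_derivative_transform_within_open)
    show "open ?W" by (intro open_chart_image open_Int open_chart_dom) auto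
    show "chart_map M i p \<in> ?W" using p by blast
  qed (auto simp: transition_chart_map)
  then have "jacobian M j k p \<circ> jacobian M i j p = jacobian M i k p"
    using transition_has_derivative[OF p(1,3)] has_derivative_unique by blast
  then show ?thesis by (simp add: fun_eq_iff)
qed

lemma jacobian_self:
  assumes p: "p \<in> chart_dom M i"
  shows "jacobian M i i p b = b"
proof -
  have "((\<lambda>y. y) has_derivative (\<lambda>b. b)) (at (chart_map M i p))" by simp
  then have "(transition M i i has_derivative (\<lambda>b. b)) (at (chart_map M i p))"
    by (rule has_derivative_transform_within_open[where s = "chart_img M i"])
       (use p open_chart_img in \<open>auto simp: chart_img_def transition_chart_map\<close>)
  from has_derivative_unique[OF transition_has_derivative[OF p p] this] show ?thesis by simp
qed

lemma tangent_space_iff: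
  "\<xi> \<in> tangent_space M p \<longleftrightarrow>
    (\<forall>i j. p \<in> chart_dom M i \<inter> chart_dom M j \<longrightarrow> \<xi> j = jacobian M i j p (\<xi> i)) \<and>
    (\<forall>i. p \<notin> chart_dom M i \<longrightarrow> \<xi> i = 0)"
  unfolding tangent_space_def by (rule mem_Collect_eq)

lemma tangent_space_jacobian:
  assumes "\<xi> \<in> tangent_space M p" "p \<in> chart_dom M i" "p \<in> chart_dom M j"
  shows "jacobian M i j p (\<xi> i) = \<xi> j"
  by (rule sym, rule conjunct1[OF assms(1)[unfolded tangent_space_iff], rule_format])
     (rule IntI[OF assms(2,3)])

lemma tangent_space_outside:
  assumes "\<xi> \<in> tangent_space M p" "p \<notin> chart_dom M i"
  shows "\<xi> i = 0"
  by (rule conjunct2[OF assms(1)[unfolded tangent_space_iff], rule_format, OF assms(2)])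

lemma tangent_spaceI:
  assumes "\<And>i j. p \<in> chart_dom M i \<Longrightarrow> p \<in> chart_dom M j \<Longrightarrow> jacobian M i j p (\<xi> i) = \<xi> j"
    and "\<And>i. p \<notin> chart_dom M i \<Longrightarrow> \<xi> i = 0"
  shows "\<xi> \<in> tangent_space M p"
  unfolding tangent_space_iff
proof (intro conjI allI impI)
  show "\<xi> j = jacobian M i j p (\<xi> i)" if "p \<in> chart_dom M i \<inter> chart_dom M j" for i j
    by (rule sym, rule assms(1)) (use that in auto)
qed (rule assms(2))

lemma subspace_tangent_space: "subspace (tangent_space M p)"
proof (rule subspaceI)
  show "0 \<in> tangent_space M p"
    by (rule tangent_spaceI) (simp_all add: linear_0[OF linear_jacobian])
next
  fix \<xi> \<eta> assume "\<xi> \<in> tangent_space M p" "\<eta> \<in> tangent_space M p"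
  then show "\<xi> + \<eta> \<in> tangent_space M p"
    by (intro tangent_spaceI)
      (simp_all add: linear_add[OF linear_jacobian] tangent_space_jacobian tangent_space_outside)
next
  fix c \<xi> assume "\<xi> \<in> tangent_space M p"
  then show "c *\<^sub>R \<xi> \<in> tangent_space M p"
    by (intro tangent_spaceI) (simp_all add: scaleR_fun_def linear_cmul[OF linear_jacobian]
        tangent_space_jacobian tangent_space_outside)
qed

sublocale tangent: inner_product_carrier "tangent_space M p" "metric M p" for p
  using metric subspace_tangent_space by unfold_locales (simp_all add: riemannian_metric_def)

lemma tvec_in_tangent_space:
  "p \<in> chart_dom M i \<Longrightarrow> tvec_of_coords M i p b \<in> tangent_space M p"
  by (intro tangent_spaceI) (simp_all add: tvec_of_coords_def jacobian_cocycle)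

lemma tvec_chart_component: "p \<in> chart_dom M i \<Longrightarrow> tvec_of_coords M i p b i = b"
  by (simp add: tvec_of_coords_def jacobian_self)

lemma tvec_of_components:
  assumes "\<xi> \<in> tangent_space M p" "p \<in> chart_dom M i"
  shows "tvec_of_coords M i p (\<xi> i) = \<xi>"
proof
  fix j
  show "tvec_of_coords M i p (\<xi> i) j = \<xi> j"
    using assms by (simp add: tvec_of_coords_def tangent_space_jacobian tangent_space_outside)
qed

lemma tvec_combination:
  assumes p: "p \<in> chart_dom M i"
  shows "tvec_of_coords M i p b = (\<Sum>c\<in>UNIV. b $ c *\<^sub>R tvec_of_coords M i p (axis c 1))"
proof
  fix j
  have "jacobian M i j p b = (\<Sum>c\<in>UNIV. b $ c *\<^sub>R jacobian M i j p (axis c 1))"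
    if j: "p \<in> chart_dom M j"
  proof -
    have "b = (\<Sum>c\<in>UNIV. b $ c *\<^sub>R axis c 1)"
      using basis_expansion[of b] by (simp add: scalar_mult_eq_scaleR)
    then have "jacobian M i j p b = jacobian M i j p (\<Sum>c\<in>UNIV. b $ c *\<^sub>R axis c 1)" by simp
    also have "\<dots> = (\<Sum>c\<in>UNIV. b $ c *\<^sub>R jacobian M i j p (axis c 1))"
      by (subst linear_sum[OF linear_jacobian[OF p j]])
        (intro sum.cong refl linear_cmul[OF linear_jacobian[OF p j]])
    finally show ?thesis .
  qed
  then show "tvec_of_coords M i p b j =
      (\<Sum>c\<in>UNIV. b $ c *\<^sub>R tvec_of_coords M i p (axis c 1)) j"
    by (simp add: tvec_of_coords_def sum_fun_apply scaleR_fun_def)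
qed

lemma metric_in_chart:
  assumes p: "p \<in> chart_dom M i"
  shows "metric M p (tvec_of_coords M i p a) (tvec_of_coords M i p b)
    = (\<Sum>c\<in>UNIV. \<Sum>d\<in>UNIV. a $ c * b $ d * gram_matrix M i p $ c $ d)"
proof -
  let ?e = "\<lambda>c. tvec_of_coords M i p (axis c 1)"
  have T: "x *\<^sub>R ?e c \<in> tangent_space M p" "?e c \<in> tangent_space M p" for x c
    using tvec_in_tangent_space[OF p] subspace_scale[OF subspace_tangent_space] by auto
  have "metric M p (tvec_of_coords M i p a) (tvec_of_coords M i p b)
      = metric M p (\<Sum>c\<in>UNIV. a $ c *\<^sub>R ?e c) (\<Sum>d\<in>UNIV. b $ d *\<^sub>R ?e d)"
    using tvec_combination[OF p] by metis
  also have "\<dots> = (\<Sum>c\<in>UNIV. \<Sum>d\<in>UNIV. metric M p (a $ c *\<^sub>R ?e c) (b $ d *\<^sub>R ?e d))"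
    using T
    by (subst tangent.sum_left)
       (auto intro!: sum.cong tangent.sum_right subspace_sum[OF subspace_tangent_space])
  also have "\<dots> = (\<Sum>c\<in>UNIV. \<Sum>d\<in>UNIV. a $ c * b $ d * gram_matrix M i p $ c $ d)"
    using T by (simp add: tangent.scale_left tangent.scale_right gram_matrix_def mult_ac)
  finally show ?thesis .
qed

lemma det_gram_pos:
  assumes p: "p \<in> chart_dom M i"
  shows "det (gram_matrix M i p) > 0"
proof (rule det_pos_if_positive_definite)
  fix b :: "real ^ 'n" assume b: "b \<noteq> 0"
  have "tvec_of_coords M i p b \<noteq> 0"
    using tvec_chart_component[OF p, of b] b by auto
  then have "0 < metric M p (tvec_of_coords M i p b) (tvec_of_coords M i p b)"
    using tangent.positive tvec_in_tangent_space[OF p] by blast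
  also have "\<dots> = b \<bullet> (gram_matrix M i p *v b)"
    unfolding metric_in_chart[OF p]
    by (simp add: inner_vec_def matrix_vector_mult_def sum_distrib_left mult_ac)
  finally show "0 < b \<bullet> (gram_matrix M i p *v b)" .
qed

lemma vol_density_pos: "y \<in> chart_img M i \<Longrightarrow> vol_density M i y > 0"
  by (simp add: vol_density_def det_gram_pos chart_inv_in_dom)

lemma smooth_gram: "smooth_on (\<lambda>y. gram_matrix M i (chart_inv M i y) $ a $ b) (chart_img M i)"
  using metric by (simp add: riemannian_metric_def)

lemma continuous_vol_density: "continuous_on (chart_img M i) (vol_density M i)"
  unfolding vol_density_def det_def
  by (intro continuous_intros smooth_on_imp_continuous_on[OF smooth_gram])

text \<open>The chart carries \<open>U\<close> to a nonempty open subset of Euclidean space, which is not a Lebesgue null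
  set, and the density that is integrated over it is strictly positive.\<close>

lemma open_volume_pos:
  assumes vol: "riemannian_volume M" and U: "open U" "U \<subseteq> chart_dom M i" "U \<noteq> {}"
  shows "emeasure (vol M) U \<noteq> 0"
proof
  assume zero: "emeasure (vol M) U = 0"
  let ?W = "chart_map M i ` U"
  have W: "open ?W" "?W \<subseteq> chart_img M i"
    using open_chart_image U by (auto simp: chart_img_def)
  have "(\<lambda>y. indicator ?W y *\<^sub>R vol_density M i y) \<in> borel_measurable borel"
    using W continuous_on_subset[OF continuous_vol_density W(2)]
    by (intro borel_measurable_continuous_on_indicator) auto
  then have "(\<lambda>y. ennreal (indicator ?W y *\<^sub>R vol_density M i y)) \<in> borel_measurable lborel"
    by simp
  moreover have eq: "ennreal (vol_density M i y) * indicator ?W y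
      = ennreal (indicator ?W y *\<^sub>R vol_density M i y)" for y
    by (simp split: split_indicator)
  moreover have "(\<integral>\<^sup>+y\<in>?W. ennreal (vol_density M i y) \<partial>lborel) = 0"
    using vol U zero unfolding riemannian_volume_def by auto
  ultimately have "AE y in lborel. ennreal (indicator ?W y *\<^sub>R vol_density M i y) = 0"
    by (simp add: nn_integral_0_iff_AE)
  then have "AE y in lborel. y \<notin> ?W"
  proof (rule AE_mp, intro AE_I2 impI notI)
    fix y assume "ennreal (indicator ?W y *\<^sub>R vol_density M i y) = 0" and y: "y \<in> ?W"
    then have "vol_density M i y \<le> 0" by (simp add: ennreal_eq_0_iff)
    then show False using vol_density_pos W(2) y by (meson not_le subsetD)
  qed
  then have "?W \<in> null_sets lborel"
    using W(1) by (subst AE_iff_null_sets) auto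
  then have "negligible ?W"
    using negligible_iff_null_sets null_sets_completionI by blast
  then show False using open_not_negligible[OF W(1)] U(3) by blast
qed


section \<open>The weighted inner product on smooth fields\<close>

text \<open>Membership in \<^const>\<open>L2_fields\<close> gives integrability of the squared norm only.
  Since \<open>E\<close> is closed under addition, polarization passes it on to the mixed terms, including
  their measurability.\<close>

lemma integrable_L2_inner:
  assumes E: "subspace E" "E \<subseteq> L2_fields M \<rho>" and uv: "u \<in> E" "v \<in> E"
  shows "integrable (vol M) (\<lambda>p. metric M p (u p) (v p) * \<rho> p)"
proof -
  let ?I = "\<lambda>w. integrable (vol M) (\<lambda>p. metric M p (w p) (w p) * \<rho> p)"
  have T: "u p \<in> tangent_space M p" "v p \<in> tangent_space M p" for p
    using uv E(2) by (auto simp: L2_fields_def vector_field_def)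
  have "?I (u + v)" "?I u" "?I v"
    using uv E(2) subspace_add[OF E(1) uv] by (auto simp: L2_fields_def)
  then have "integrable (vol M) (\<lambda>p. (metric M p ((u + v) p) ((u + v) p) * \<rho> p
      - metric M p (u p) (u p) * \<rho> p - metric M p (v p) (v p) * \<rho> p) / 2)"
    by (intro integrable_divide Bochner_Integration.integrable_diff)
  moreover have "(metric M p ((u + v) p) ((u + v) p) * \<rho> p
      - metric M p (u p) (u p) * \<rho> p - metric M p (v p) (v p) * \<rho> p) / 2
      = metric M p (u p) (v p) * \<rho> p" for p
    using T[of p] tangent.commute[of "v p" p "u p"]
      subspace_add[OF subspace_tangent_space T(1) T(2), of p]
    by (simp add: tangent.add_left tangent.add_right algebra_simps)
  ultimately show ?thesis by simp
qed

text \<open>Definiteness fails for general square integrable representatives, which may vanish almost everywhere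
  without being 0.  For a smooth field some component in some chart is nonzero on a whole open set.\<close>

lemma L2_inner_pos:
  assumes vol: "riemannian_volume M" and \<rho>: "\<And>p. \<rho> p > 0"
    and u: "smooth_vector_field M u" "u \<noteq> 0"
    and int: "integrable (vol M) (\<lambda>p. metric M p (u p) (u p) * \<rho> p)"
  shows "L2_inner M \<rho> u u > 0"
proof (rule ccontr)
  assume "\<not> L2_inner M \<rho> u u > 0"
  have T: "u p \<in> tangent_space M p" for p
    using u(1) by (simp add: smooth_vector_field_def vector_field_def)
  have nonneg: "metric M p (u p) (u p) * \<rho> p \<ge> 0" for p
    using tangent.nonneg[OF T] \<rho>[of p] by simp
  then have "L2_inner M \<rho> u u \<ge> 0"
    unfolding L2_inner_def by (intro integral_nonneg_AE) auto
  then have "L2_inner M \<rho> u u = 0" using \<open>\<not> L2_inner M \<rho> u u > 0\<close> by simp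
  then have ae: "AE p in vol M. metric M p (u p) (u p) * \<rho> p = 0"
    using integral_nonneg_eq_0_iff_AE[OF int] nonneg by (simp add: L2_inner_def)
  obtain p j where pj: "u p j \<noteq> 0"
    using u(2) by (metis ext zero_fun_apply)
  then have p: "p \<in> chart_dom M j" using tangent_space_outside[OF T] by blast
  define W where "W = {y \<in> chart_img M j. u (chart_inv M j y) j \<noteq> 0}"
  define U where "U = {q \<in> chart_dom M j. chart_map M j q \<in> W}"
  have "continuous_on (chart_img M j) (\<lambda>y. u (chart_inv M j y) j)"
    using u(1) by (simp add: smooth_vector_field_def smooth_on_imp_continuous_on)
  then have "open (chart_img M j \<inter> (\<lambda>y. u (chart_inv M j y) j) -` (- {0}))"
    using open_chart_img by (intro continuous_open_preimage) auto
  then have "open W" by (simp add: W_def vimage_def Int_def)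
  then have U: "open U" unfolding U_def by (rule open_chart_preimage)
  have "p \<in> U" using p pj by (simp add: U_def W_def chart_inv_map chart_map_in_img)
  have "AE q in vol M. q \<notin> U"
  proof (rule AE_mp[OF ae], intro AE_I2 impI notI)
    fix q assume "metric M q (u q) (u q) * \<rho> q = 0" "q \<in> U"
    then have "u q = 0" using tangent.eq_0_iff[OF T] \<rho>[of q] by auto
    then show False using \<open>q \<in> U\<close> by (auto simp: U_def W_def chart_inv_map)
  qed
  moreover have "U \<in> sets (vol M)" using vol U by (simp add: riemannian_volume_def)
  ultimately have "U \<in> null_sets (vol M)" by (subst AE_iff_null_sets)
  then have "emeasure (vol M) U = 0" by (rule null_setsD1)
  then show False using open_volume_pos[OF vol U] \<open>p \<in> U\<close> by (auto simp: U_def)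
qed

lemma L2_inner_product_on:
  assumes vol: "riemannian_volume M" and \<rho>: "\<And>p. \<rho> p > 0"
    and E: "subspace E" "E \<subseteq> L2_fields M \<rho>" "\<And>v. v \<in> E \<Longrightarrow> smooth_vector_field M v"
  shows "inner_product_on E (L2_inner M \<rho>)"
proof -
  note int = integrable_L2_inner[OF E(1,2)]
  have T: "u p \<in> tangent_space M p" if "u \<in> E" for u p
    using E(3)[OF that] by (simp add: smooth_vector_field_def vector_field_def)
  show ?thesis
    unfolding inner_product_on_def
  proof (intro conjI ballI allI impI)
    show "L2_inner M \<rho> u v = L2_inner M \<rho> v u" if "u \<in> E" "v \<in> E" for u v
      unfolding L2_inner_def using tangent.commute[OF T[OF that(1)] T[OF that(2)]] by simp
    show "L2_inner M \<rho> (u + v) w = L2_inner M \<rho> u w + L2_inner M \<rho> v w"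
      if "u \<in> E" "v \<in> E" "w \<in> E" for u v w
      using that int[of u w] int[of v w]
      by (simp add: L2_inner_def tangent.add_left T distrib_right)
    show "L2_inner M \<rho> (c *\<^sub>R u) v = c * L2_inner M \<rho> u v" if "u \<in> E" "v \<in> E" for c u v
      using that by (simp add: L2_inner_def scaleR_fun_def[of c u] tangent.scale_left T mult.assoc)
    show "L2_inner M \<rho> u u > 0" if "u \<in> E" "u \<noteq> 0" for u
      using that by (intro L2_inner_pos vol \<rho> E int)
  qed
qed

section \<open>Reproducing kernels of finite-dimensional spaces of fields\<close>

definition kernel_sections ::
    "('i, 'm, 'n) vkernel \<Rightarrow> ('i, 'm, 'n) vfield set"
  where "kernel_sections k = {(\<lambda>y. k x y \<xi>) |x \<xi>. \<xi> \<in> tangent_space M x}"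

lemma is_rkhsD:
  assumes "is_rkhs M k H ip"
  shows rkhs_fields: "H \<subseteq> {v. vector_field M v}"
    and rkhs_hilbert: "hilbert_space_on H ip"
    and rkhs_section: "\<xi> \<in> tangent_space M x \<Longrightarrow> (\<lambda>y. k x y \<xi>) \<in> H"
    and rkhs_reproducing: "v \<in> H \<Longrightarrow> \<xi> \<in> tangent_space M x \<Longrightarrow>
      ip v (\<lambda>y. k x y \<xi>) = metric M x (v x) \<xi>"
    and rkhs_outside: "u \<notin> H \<or> v \<notin> H \<Longrightarrow> ip u v = 0"
proof -
  note H = assms[unfolded is_rkhs_def]
  show "H \<subseteq> {v. vector_field M v}" by (rule conjunct1[OF H])
  show "hilbert_space_on H ip" by (rule conjunct1[OF conjunct2[OF H]])
  show "(\<lambda>y. k x y \<xi>) \<in> H" if "\<xi> \<in> tangent_space M x"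
    by (rule conjunct1[OF conjunct2[OF conjunct2[OF H]], rule_format, OF that])
  show "ip v (\<lambda>y. k x y \<xi>) = metric M x (v x) \<xi>" if "v \<in> H" "\<xi> \<in> tangent_space M x"
    by (rule conjunct1[OF conjunct2[OF conjunct2[OF conjunct2[OF H]]], rule_format, OF that])
  show "ip u v = 0" if "u \<notin> H \<or> v \<notin> H"
    by (rule conjunct2[OF conjunct2[OF conjunct2[OF conjunct2[OF H]]], rule_format, OF that])
qed

lemma rkhs_inner_product_carrier: "is_rkhs M k H ip \<Longrightarrow> inner_product_carrier H ip"
  using rkhs_hilbert by (auto simp: inner_product_carrier_def hilbert_space_on_def)

lemma rkhs_contains_sections: "is_rkhs M k H ip \<Longrightarrow> kernel_sections k \<subseteq> H"
  unfolding kernel_sections_def using rkhs_section by blast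

text \<open>A field in \<open>H\<close> that is orthogonal to all kernel sections vanishes at every point by the
  reproducing property.  The residual of the projection onto the span of the sections is such a
  field; the projection exists because the span is finite dimensional.\<close>

lemma rkhs_eq_span_sections:
  assumes H: "is_rkhs M k H ip" and fd: "finite_dimensional (span (kernel_sections k))"
  shows "H = span (kernel_sections k)"
proof
  interpret inner_product_carrier H ip
    by (rule rkhs_inner_product_carrier[OF H])
  have KH: "kernel_sections k \<subseteq> H" by (rule rkhs_contains_sections[OF H])
  then show sub: "span (kernel_sections k) \<subseteq> H" by (rule span_carrier)
  obtain B where B: "orthonormal B" "span B = span (kernel_sections k)"
    using orthonormal_basis_exists[OF fd sub] .
  show "H \<subseteq> span (kernel_sections k)"
  proof
    fix v assume v: "v \<in> H"
    define r where "r = v - projection B v"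
    have r: "r \<in> H"
      unfolding r_def
      using subspace_diff[OF subspace_carrier v] projection_in_span[of B v] B(2) sub by blast
    then have T: "r x \<in> tangent_space M x" for x
      using rkhs_fields[OF H] unfolding vector_field_def by blast
    have "r x = 0" for x
    proof -
      have "(\<lambda>y. k x y (r x)) \<in> span B"
        unfolding B(2) kernel_sections_def by (rule span_base) (use T in blast)
      then have "ip r (\<lambda>y. k x y (r x)) = 0"
        unfolding r_def by (rule residual_orthogonal[OF B(1) v])
      then have "metric M x (r x) (r x) = 0" using rkhs_reproducing[OF H r T] by simp
      then show ?thesis by (simp only: tangent.eq_0_iff[OF T])
    qed
    then have "r = 0" by (intro ext) simp
    then show "v \<in> span (kernel_sections k)"
      using projection_in_span[of B v] B(2) by (simp add: r_def)
  qed
qed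

text \<open>The span of the sections is determined by \<open>k\<close> alone and is contained in \<open>H\<close>, hence finite
  dimensional, so every reproducing kernel Hilbert space of \<open>k\<close> is equal to it.  The reproducing
  property fixes the inner product with a section, and thereby the whole inner product.\<close>

lemma rkhs_eqI:
  assumes H: "is_rkhs M k H ip" and fd: "finite_dimensional H"
  shows "rkhs M k = (H, ip)"
proof -
  have fdS: "finite_dimensional (span (kernel_sections k))"
  proof -
    have "kernel_sections k \<subseteq> H" by (rule rkhs_contains_sections[OF H])
    obtain A where A: "finite A" "H = span A" using fd by (auto simp: finite_dimensional_def)
    obtain B where B: "B \<subseteq> kernel_sections k" "independent B" "kernel_sections k \<subseteq> span B"
      using maximal_independent_subset[of "kernel_sections k"] by blast
    have "finite B"
      using independent_span_bound[OF A(1) B(2)] B(1) \<open>kernel_sections k \<subseteq> H\<close> A(2) by blast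
    moreover have "span (kernel_sections k) = span B"
      using B by (meson antisym span_minimal span_mono subspace_span)
    ultimately show ?thesis by (auto simp: finite_dimensional_def)
  qed
  have HS: "H = span (kernel_sections k)" by (rule rkhs_eq_span_sections[OF H fdS])
  have unique: "H' = H \<and> ip' = ip" if H': "is_rkhs M k H' ip'" for H' ip'
  proof
    show eq: "H' = H" using rkhs_eq_span_sections[OF H' fdS] HS by simp
    interpret I: inner_product_carrier H ip
      by (rule rkhs_inner_product_carrier[OF H])
    interpret I': inner_product_carrier H ip'
      using rkhs_inner_product_carrier[OF H'] eq by simp
    have "ip' u v = ip u v" if u: "u \<in> H" and v: "v \<in> H" for u v
    proof -
      have "v \<in> H \<and> ip' u v = ip u v"
      proof (rule span_induct[of v "kernel_sections k" "\<lambda>v. v \<in> H \<and> ip' u v = ip u v"])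
        show "v \<in> span (kernel_sections k)" using v HS by simp
        show "subspace {v. v \<in> H \<and> ip' u v = ip u v}"
          unfolding subspace_def using I.subspace_carrier u
          by (auto simp: subspace_0 subspace_add subspace_scale I.zero_right I'.zero_right
              I.add_right I'.add_right I.scale_right I'.scale_right)
        fix s assume "s \<in> kernel_sections k"
        then obtain x \<xi> where s: "\<xi> \<in> tangent_space M x" "s = (\<lambda>y. k x y \<xi>)"
          by (auto simp: kernel_sections_def)
        then show "s \<in> H \<and> ip' u s = ip u s"
          using rkhs_reproducing[OF H u] rkhs_reproducing[OF H', of u] rkhs_section[OF H] u eq
          by simp
      qed
      then show ?thesis ..
    qed
    moreover have "ip' u v = ip u v" if "u \<notin> H \<or> v \<notin> H" for u v
      using rkhs_outside[OF H that] rkhs_outside[OF H', of u v] that eq by simp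
    ultimately show "ip' = ip" by (intro ext) blast
  qed
  show ?thesis
    unfolding rkhs_def
  proof (rule the_equality)
    show "case (H, ip) of (H, ip) \<Rightarrow> is_rkhs M k H ip" using H by simp
    fix Z assume "case Z of (H, ip) \<Rightarrow> is_rkhs M k H ip"
    then show "Z = (H, ip)" using unique[of "fst Z" "snd Z"] by (cases Z) simp
  qed
qed

definition basis_kernel ::
    "('i, 'm, 'n) vfield set \<Rightarrow> ('i, 'm, 'n) vkernel"
  where "basis_kernel B x y \<xi> = (\<Sum>e\<in>B. metric M x (e x) \<xi> *\<^sub>R e y)"

lemma metric_basis_kernel:
  assumes "\<And>e. e \<in> B \<Longrightarrow> vector_field M e" "\<eta> \<in> tangent_space M y"
  shows "metric M y (basis_kernel B x y \<xi>) \<eta>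
    = (\<Sum>e\<in>B. metric M x (e x) \<xi> * metric M y (e y) \<eta>)"
proof -
  have T: "e y \<in> tangent_space M y" if "e \<in> B" for e
    using assms(1)[OF that] by (simp add: vector_field_def)
  have "metric M y (basis_kernel B x y \<xi>) \<eta> = (\<Sum>e\<in>B. metric M y (metric M x (e x) \<xi> *\<^sub>R e y) \<eta>)"
    unfolding basis_kernel_def using T assms(2) subspace_scale[OF subspace_tangent_space]
    by (intro tangent.sum_left) auto
  also have "\<dots> = (\<Sum>e\<in>B. metric M x (e x) \<xi> * metric M y (e y) \<eta>)"
    using T assms(2) by (intro sum.cong refl tangent.scale_left)
  finally show ?thesis .
qed

lemma vector_kernel_basis_kernel:
  assumes B: "\<And>e. e \<in> B \<Longrightarrow> vector_field M e"
  shows "vector_kernel M (basis_kernel B)"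
  unfolding vector_kernel_def
proof (intro conjI allI ballI impI)
  have T: "e x \<in> tangent_space M x" if "e \<in> B" for e x
    using B[OF that] by (simp add: vector_field_def)
  show "basis_kernel B x y \<xi> \<in> tangent_space M y" for x y \<xi>
    unfolding basis_kernel_def
    by (intro subspace_sum subspace_scale subspace_tangent_space T)
  show "basis_kernel B x y (\<xi> + \<eta>) = basis_kernel B x y \<xi> + basis_kernel B x y \<eta>"
    if "\<xi> \<in> tangent_space M x" "\<eta> \<in> tangent_space M x" for x y \<xi> \<eta>
    unfolding basis_kernel_def sum.distrib[symmetric] using that T
    by (intro sum.cong refl) (simp add: tangent.add_right scaleR_left_distrib)
  show "basis_kernel B x y (c *\<^sub>R \<xi>) = c *\<^sub>R basis_kernel B x y \<xi>"
    if "\<xi> \<in> tangent_space M x" for x y c \<xi>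
    unfolding basis_kernel_def scaleR_right.sum using that T
    by (intro sum.cong refl) (simp add: tangent.scale_right)
  show "metric M y (basis_kernel B x y \<xi>) \<eta> = metric M x \<xi> (basis_kernel B y x \<eta>)"
    if \<xi>: "\<xi> \<in> tangent_space M x" and \<eta>: "\<eta> \<in> tangent_space M y" for x y \<xi> \<eta>
  proof -
    have "basis_kernel B y x \<eta> \<in> tangent_space M x"
      unfolding basis_kernel_def
      by (intro subspace_sum subspace_scale subspace_tangent_space T)
    then have "metric M x \<xi> (basis_kernel B y x \<eta>) = metric M x (basis_kernel B y x \<eta>) \<xi>"
      by (rule tangent.commute[OF \<xi>])
    then show ?thesis
      using metric_basis_kernel[OF B \<xi>] metric_basis_kernel[OF B \<eta>] by (simp add: mult.commute)
  qed
  \<comment> \<open>The quadratic form is a sum of squares, one for each element of \<open>B\<close>.\<close>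
  fix N :: nat and x :: "nat \<Rightarrow> 'm" and \<xi> :: "nat \<Rightarrow> ('i, 'n) tvec"
  assume \<xi>: "\<forall>a<N. \<xi> a \<in> tangent_space M (x a)"
  let ?c = "\<lambda>e a. metric M (x a) (e (x a)) (\<xi> a)"
  have "(\<Sum>a<N. \<Sum>b<N. metric M (x b) (basis_kernel B (x a) (x b) (\<xi> a)) (\<xi> b))
      = (\<Sum>a<N. \<Sum>b<N. \<Sum>e\<in>B. ?c e a * ?c e b)"
    using \<xi> by (intro sum.cong refl metric_basis_kernel B) auto
  also have "\<dots> = (\<Sum>a<N. \<Sum>e\<in>B. \<Sum>b<N. ?c e a * ?c e b)"
    by (intro sum.cong refl sum.swap)
  also have "\<dots> = (\<Sum>e\<in>B. \<Sum>a<N. \<Sum>b<N. ?c e a * ?c e b)"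
    by (rule sum.swap)
  also have "\<dots> = (\<Sum>e\<in>B. (\<Sum>a<N. ?c e a)\<^sup>2)"
    by (simp add: power2_eq_square sum_product)
  also have "\<dots> \<ge> 0" by (intro sum_nonneg) auto
  finally show "0 \<le> (\<Sum>a<N. \<Sum>b<N. metric M (x b) (basis_kernel B (x a) (x b) (\<xi> a)) (\<xi> b))" .
qed

text \<open>In the chart the pairing is \<open>\<Sum>\<^sub>c\<^sub>d e\<^sub>c b\<^sub>d g\<^sub>c\<^sub>d\<close>.  The coefficient \<open>e\<^sub>c b\<^sub>d\<close> is written as the inner
  product of \<open>e\<close> with the vector \<open>b\<^sub>d\<close> times the \<open>c\<close>-th unit vector, which makes it a
  smooth expression in \<open>e\<close>.\<close>

lemma smooth_metric_coords:
  assumes e: "smooth_vector_field M e"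
  shows "smooth_on (\<lambda>z. metric M (chart_inv M i z) (e (chart_inv M i z))
      (tvec_of_coords M i (chart_inv M i z) b)) (chart_img M i)"
proof (rule smooth_on_cong[OF open_chart_img])
  let ?e = "\<lambda>z. e (chart_inv M i z) i"
  let ?G = "\<lambda>z. gram_matrix M i (chart_inv M i z)"
  have "smooth_on ?e (chart_img M i)" using e by (simp add: smooth_vector_field_def)
  then show "smooth_on (\<lambda>z. \<Sum>c\<in>UNIV. \<Sum>d\<in>UNIV. (?e z \<bullet> axis c (b $ d)) *\<^sub>R (?G z $ c $ d))
      (chart_img M i)"
    by (intro smooth_on_sum smooth_on_scaleR smooth_on_inner smooth_on_const smooth_gram
        open_chart_img)
  fix z assume "z \<in> chart_img M i"
  then have p: "chart_inv M i z \<in> chart_dom M i" by (rule chart_inv_in_dom)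
  have "tvec_of_coords M i (chart_inv M i z) (?e z) = e (chart_inv M i z)"
    using e by (intro tvec_of_components p) (simp add: smooth_vector_field_def vector_field_def)
  then show "(\<Sum>c\<in>UNIV. \<Sum>d\<in>UNIV. (?e z \<bullet> axis c (b $ d)) *\<^sub>R (?G z $ c $ d)) =
      metric M (chart_inv M i z) (e (chart_inv M i z)) (tvec_of_coords M i (chart_inv M i z) b)"
    using metric_in_chart[OF p, of "?e z" b] by (simp add: inner_axis)
qed

lemma smooth_kernel_basis_kernel:
  assumes B: "\<And>e. e \<in> B \<Longrightarrow> smooth_vector_field M e"
  shows "smooth_kernel M (basis_kernel B)"
  unfolding smooth_kernel_def
proof (intro allI)
  fix i j :: 'i and b :: "real ^ 'n"
  let ?S = "chart_img M i \<times> chart_img M j"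
  let ?f = "\<lambda>e z. metric M (chart_inv M i z) (e (chart_inv M i z))
      (tvec_of_coords M i (chart_inv M i z) b)"
  have S: "open ?S" by (intro open_Times open_chart_img)
  have "smooth_on (\<lambda>w. ?f e (fst w)) ?S" if "e \<in> B" for e
    by (rule smooth_on_compose_linear[OF open_chart_img S bounded_linear_fst _
          smooth_metric_coords[OF B[OF that]]]) auto
  moreover have "smooth_on (\<lambda>w. e (chart_inv M j (snd w)) j) ?S" if "e \<in> B" for e
    by (rule smooth_on_compose_linear[OF open_chart_img S bounded_linear_snd])
       (use B[OF that] in \<open>auto simp: smooth_vector_field_def\<close>)
  ultimately have "smooth_on (\<lambda>w. \<Sum>e\<in>B. ?f e (fst w) *\<^sub>R e (chart_inv M j (snd w)) j) ?S"
    by (intro smooth_on_sum smooth_on_scaleR S)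
  then show "smooth_on (\<lambda>(z, w). basis_kernel B (chart_inv M i z) (chart_inv M j w)
      (tvec_of_coords M i (chart_inv M i z) b) j) ?S"
    by (simp add: basis_kernel_def sum_fun_apply scaleR_fun_def case_prod_unfold)
qed

text \<open>With an orthonormal basis \<open>B\<close>, the section of \<^term>\<open>basis_kernel B\<close> at \<open>x\<close> and \<open>\<xi>\<close> has the
  coefficients \<open>metric M x (e x) \<xi>\<close>, so its inner product with \<open>v\<close> is the expansion of \<open>v\<close> in \<open>B\<close>,
  evaluated at \<open>x\<close> and paired with \<open>\<xi>\<close>.\<close>

lemma kernel_with_rkhs_exists:
  assumes fd: "finite_dimensional E" and E: "\<And>v. v \<in> E \<Longrightarrow> smooth_vector_field M v"
    and ip: "inner_product_on E ip" and outside: "\<And>u v. u \<notin> E \<or> v \<notin> E \<Longrightarrow> ip u v = 0"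
  shows "\<exists>k. vector_kernel M k \<and> smooth_kernel M k \<and> is_rkhs M k E ip"
proof -
  interpret inner_product_carrier E ip
    using fd ip by unfold_locales (auto simp: finite_dimensional_def)
  obtain B where B: "orthonormal B" "span B = E"
    using orthonormal_basis_exists[OF fd] by auto
  have BE: "B \<subseteq> E" using B by (simp add: orthonormal_def)
  have T: "v x \<in> tangent_space M x" if "v \<in> E" for v x
    using E[OF that] by (simp add: smooth_vector_field_def vector_field_def)
  have section_eq: "(\<lambda>y. basis_kernel B x y \<xi>) = (\<Sum>e\<in>B. metric M x (e x) \<xi> *\<^sub>R e)" for x \<xi>
    by (rule ext) (simp add: basis_kernel_def sum_fun_apply scaleR_fun_def)
  have "is_rkhs M (basis_kernel B) E ip"
    unfolding is_rkhs_def
  proof (intro conjI ballI allI impI)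
    show "E \<subseteq> {v. vector_field M v}" using E by (auto simp: smooth_vector_field_def)
    show "hilbert_space_on E ip" by (rule finite_dimensional_complete[OF fd])
    show "(\<lambda>y. basis_kernel B x y \<xi>) \<in> E" for x \<xi>
      unfolding section_eq using BE
      by (intro subspace_sum subspace_scale subspace_carrier) auto
    show "ip v (\<lambda>y. basis_kernel B x y \<xi>) = metric M x (v x) \<xi>"
      if v: "v \<in> E" and \<xi>: "\<xi> \<in> tangent_space M x" for v x \<xi>
    proof -
      have "ip v (\<lambda>y. basis_kernel B x y \<xi>) = (\<Sum>e\<in>B. ip v (metric M x (e x) \<xi> *\<^sub>R e))"
        unfolding section_eq using BE v subspace_scale[OF subspace_carrier]
        by (intro sum_right) auto
      also have "\<dots> = (\<Sum>e\<in>B. metric M x (ip v e *\<^sub>R e x) \<xi>)"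
        using BE v \<xi> T by (intro sum.cong refl) (auto simp: scale_right tangent.scale_left)
      also have "\<dots> = metric M x (\<Sum>e\<in>B. ip v e *\<^sub>R e x) \<xi>"
        using BE T \<xi> subspace_scale[OF subspace_tangent_space]
        by (intro tangent.sum_left[symmetric]) auto
      also have "(\<Sum>e\<in>B. ip v e *\<^sub>R e x) = projection B v x"
        by (simp add: projection_def sum_fun_apply scaleR_fun_def)
      also have "projection B v = v" using projection_span[OF B(1)] v B(2) by simp
      finally show ?thesis .
    qed
  qed (rule outside)
  moreover have smooth: "smooth_vector_field M e" if "e \<in> B" for e using E BE that by blast
  moreover have "vector_kernel M (basis_kernel B)"
    using smooth by (intro vector_kernel_basis_kernel) (simp add: smooth_vector_field_def)
  ultimately show ?thesis using smooth_kernel_basis_kernel by blast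
qed

section \<open>Realization of the operator \<open>S\<^sub>\<rho>\<close>\<close>

text \<open>The adjoint of the inclusion is characterized by its representer equation, whose solution is
  unique because the inner product of \<open>H\<close> is definite.\<close>

lemma stein_operator_eqI:
  assumes H: "is_rkhs M k H ip" and fd: "finite_dimensional H"
    and w: "w \<in> H" "\<And>v. v \<in> H \<Longrightarrow> ip v w = L2_inner M \<rho> v u"
  shows "stein_operator M \<rho> k u = w"
proof -
  interpret inner_product_carrier H ip
    by (rule rkhs_inner_product_carrier[OF H])
  note eq = rkhs_eqI[OF H fd]
  have "w' = w" if w': "w' \<in> H" "\<And>v. v \<in> H \<Longrightarrow> ip v w' = L2_inner M \<rho> v u" for w'
  proof -
    have d: "w' - w \<in> H" using subspace_diff[OF subspace_carrier w'(1) w(1)] .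
    then have "ip (w' - w) (w' - w) = ip (w' - w) w' - ip (w' - w) w"
      using commute[OF d w(1)] commute[OF d w'(1)] diff_left[OF w'(1) w(1) d] by simp
    also have "\<dots> = 0" using w(2)[OF d] w'(2)[OF d] by simp
    finally show ?thesis using eq_0_iff[OF d] by simp
  qed
  then have "(THE w. w \<in> H \<and> (\<forall>v\<in>H. ip v w = L2_inner M \<rho> v u)) = w"
    using w by (intro the_equality conjI ballI) blast+
  then show ?thesis
    by (simp add: stein_operator_def incl_adjoint_def incl_def rkhs_space_def rkhs_inner_def eq)
qed

text \<open>Take for \<open>ip\<close> the inner product on \<open>E\<close> dual to \<open>R\<close>.  The representer equation for \<open>S\<^sub>\<rho> u\<close> is then
  solved by \<open>R u\<close>.\<close>

lemma stein_realization:
  assumes vol: "riemannian_volume M" and \<rho>: "\<And>p. \<rho> p > 0"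
    and E: "finite_dimensional E" "E \<subseteq> L2_fields M \<rho>" "\<And>v. v \<in> E \<Longrightarrow> smooth_vector_field M v"
    and R: "pos_def_self_adjoint_on M \<rho> E R"
  shows "\<exists>k. smooth_finite_rank_kernel_with_rkhs M k E \<and> (\<forall>u\<in>E. stein_operator M \<rho> k u = R u)"
proof -
  have "subspace E" using E(1) by (simp add: finite_dimensional_def)
  then interpret inner_product_carrier E "L2_inner M \<rho>"
    using L2_inner_product_on[OF vol \<rho> _ E(2,3)] by unfold_locales
  obtain ip where ip: "inner_product_on E ip"
    "\<And>u v. u \<in> E \<Longrightarrow> v \<in> E \<Longrightarrow> ip v (R u) = L2_inner M \<rho> v u"
    by (rule dual_inner_product[OF E(1), of R])
      (use R in \<open>auto simp: pos_def_self_adjoint_on_def\<close>)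
  \<comment> \<open>Extension by 0 is the normalization in \<^const>\<open>is_rkhs\<close>.\<close>
  define ipE where "ipE u v = (if u \<in> E \<and> v \<in> E then ip u v else 0)" for u v
  have ipE: "inner_product_on E ipE"
  proof -
    interpret I: inner_product_carrier E ip using ip(1) subspace_carrier by unfold_locales
    show ?thesis
      unfolding inner_product_on_def ipE_def
      using subspace_add[OF subspace_carrier] subspace_scale[OF subspace_carrier]
      by (auto simp: I.add_left I.scale_left I.positive intro: I.commute)
  qed
  have "\<exists>k. vector_kernel M k \<and> smooth_kernel M k \<and> is_rkhs M k E ipE"
    by (rule kernel_with_rkhs_exists) (use E ipE in \<open>auto simp: ipE_def\<close>)
  then obtain k where k: "vector_kernel M k" "smooth_kernel M k" "is_rkhs M k E ipE" by blast
  have "rkhs_space M k = E" using rkhs_eqI[OF k(3) E(1)] by (simp add: rkhs_space_def)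
  then have "smooth_finite_rank_kernel_with_rkhs M k E"
    using k E(1) by (auto simp: smooth_finite_rank_kernel_with_rkhs_def finite_rank_def)
  moreover have "stein_operator M \<rho> k u = R u" if "u \<in> E" for u
    using that R ip(2)
    by (intro stein_operator_eqI[OF k(3) E(1)])
       (auto simp: ipE_def pos_def_self_adjoint_on_def)
  ultimately show ?thesis by blast
qed

lemma scaling_pos_def_self_adjoint:
  assumes vol: "riemannian_volume M" and \<rho>: "\<And>p. \<rho> p > 0"
    and E: "subspace E" "E \<subseteq> L2_fields M \<rho>" "\<And>v. v \<in> E \<Longrightarrow> smooth_vector_field M v"
    and a: "a > 0"
  shows "pos_def_self_adjoint_on M \<rho> E (\<lambda>u. a *\<^sub>R u)"
proof -
  interpret inner_product_carrier E "L2_inner M \<rho>"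
    using L2_inner_product_on[OF vol \<rho> E] E(1) by unfold_locales
  show ?thesis
    unfolding pos_def_self_adjoint_on_def using a subspace_scale[OF E(1)]
    by (auto simp: scaleR_right_distrib scale_left scale_right positive)
qed

end

theorem proposition7p6:
  fixes M :: "('i, 'm::{t2_space, second_countable_topology}, 'n::finite) riemannian"
    and \<rho> :: "'m \<Rightarrow> real"
    and E :: "('i, 'm, 'n) vfield set"
  assumes "closed_oriented_riemannian_manifold M"
    and "smooth_positive_density M \<rho>"
    and "E \<subseteq> wasserstein_tangent_space M \<rho> \<inter> {v. smooth_vector_field M v}"
    and "finite_dimensional E"
  shows "(\<forall>R. pos_def_self_adjoint_on M \<rho> E R \<longrightarrow>
           (\<exists>k. smooth_finite_rank_kernel_with_rkhs M k E \<and>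
                (\<forall>u\<in>E. stein_operator M \<rho> k u = R u) \<and>
                (\<forall>f u. smooth_function M f \<and> u = gradient M f \<and> u \<in> E \<longrightarrow>
                   stein_law_tangent M \<rho> k f = law_operator M \<rho> (R u))))
       \<and> (pos_def_self_adjoint_on M \<rho> E (\<lambda>u. u) \<and>
           (\<exists>k. smooth_finite_rank_kernel_with_rkhs M k E \<and>
                (\<forall>u\<in>E. stein_operator M \<rho> k u = u \<and> stein_response M \<rho> k u = otto_response u)))
       \<and> (\<forall>a>0. pos_def_self_adjoint_on M \<rho> E (\<lambda>u. a *\<^sub>R u) \<and>
           (\<exists>k. smooth_finite_rank_kernel_with_rkhs M k E \<and>
                (\<forall>u\<in>E. stein_operator M \<rho> k u = a *\<^sub>R u)))"
proof -
  interpret riemannian_manifold M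
    using assms(1) by unfold_locales (auto simp: closed_oriented_riemannian_manifold_def)
  have vol: "riemannian_volume M"
    using assms(1) by (simp add: closed_oriented_riemannian_manifold_def)
  have \<rho>: "\<rho> p > 0" for p using assms(2) by (simp add: smooth_positive_density_def)
  have sub: "subspace E" using assms(4) by (simp add: finite_dimensional_def)
  have E: "E \<subseteq> L2_fields M \<rho>" "\<And>v. v \<in> E \<Longrightarrow> smooth_vector_field M v"
    using assms(3) by (auto simp: wasserstein_tangent_space_def)
  have realize: "\<exists>k. smooth_finite_rank_kernel_with_rkhs M k E \<and>
      (\<forall>u\<in>E. stein_operator M \<rho> k u = R u)" if "pos_def_self_adjoint_on M \<rho> E R" for R
    using that by (intro stein_realization vol \<rho> assms(4) E)
  have scaling: "pos_def_self_adjoint_on M \<rho> E (\<lambda>u. a *\<^sub>R u)" if "a > 0" for a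
    using that by (intro scaling_pos_def_self_adjoint vol \<rho> sub E)
  have id: "pos_def_self_adjoint_on M \<rho> E (\<lambda>u. u)" using scaling[of 1] by simp
  show ?thesis
  proof (intro conjI allI impI)
    fix R assume "pos_def_self_adjoint_on M \<rho> E R"
    then obtain k where "smooth_finite_rank_kernel_with_rkhs M k E"
      "\<forall>u\<in>E. stein_operator M \<rho> k u = R u" using realize by blast
    then show "\<exists>k. smooth_finite_rank_kernel_with_rkhs M k E \<and>
        (\<forall>u\<in>E. stein_operator M \<rho> k u = R u) \<and>
        (\<forall>f u. smooth_function M f \<and> u = gradient M f \<and> u \<in> E \<longrightarrow>
           stein_law_tangent M \<rho> k f = law_operator M \<rho> (R u))"
      by (auto simp: stein_law_tangent_def)
  next
    show "\<exists>k. smooth_finite_rank_kernel_with_rkhs M k E \<and>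
        (\<forall>u\<in>E. stein_operator M \<rho> k u = u \<and> stein_response M \<rho> k u = otto_response u)"
      using realize[OF id] by (simp add: stein_response_def otto_response_def)
  next
    fix a :: real assume "a > 0"
    then show "pos_def_self_adjoint_on M \<rho> E (\<lambda>u. a *\<^sub>R u)" by (rule scaling)
    then show "\<exists>k. smooth_finite_rank_kernel_with_rkhs M k E \<and>
        (\<forall>u\<in>E. stein_operator M \<rho> k u = a *\<^sub>R u)" by (rule realize)
  qed (rule id)
qed

end
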